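(* There exist $0<\beta_1<\beta_2<1<\beta_3$, $\alpha\in(0,1)$, $\tau_1>0$ and $\tau_\infty$ such that $$\begin{aligned} &(1-2(1-\beta_1)+2(1-\beta_2))\,\tau_1=1-\alpha,\\ &(1-2(1-\beta_1)^2+2(1-\beta_2)^2)\,\tau_1=2,\\ &(1-2(1-\beta_1)^3+2(1-\beta_2)^3)\,\tau_1=3,\\ &2(\beta_1+\beta_2+\beta_3)+(\alpha^2-1)\textstyle\sum_{1\le j<k\le3}\beta_j\beta_k=3,\\ &\beta_1+\beta_2+\beta_3-\textstyle\sum_{1\le j<k\le3}\beta_j\beta_k-\beta_1\beta_2\beta_3(\alpha^3-1)=1,\\ &\tau_\infty=\tau_1/(1-\alpha). \end{aligned}$$ This system has a unique solution satisfying these inequalities, namely $\alpha^*\approx0.1660687$, $\tau_1^*\approx4.2479105$, $\tau_\infty^*\approx5.0938372$, $\beta_1^*\approx0.4698574$, $\beta_2^*\approx0.8716996$, $\beta_3^*\approx1.0283610$. With $\beta_k=\beta_k^*$, the optimal solution of problem (R) in the context satisfies, for all $i\in\{0,1,2,\dots\}$, $y(\tau_i)={\alpha^*}^i e_1$, where $\tau_i:=\frac{1-{\alpha^*}^i}{1-\alpha^*}\tau_1^*$ are the junction times. For every $i\ge1$ the optimal control in $(\tau_{i-1},\tau_i)$ is, for $\beta\in(0,1)$, $$v^*((1-\beta)\tau_{i-1}+\beta\tau_i)=\begin{cases}-1,&\beta\in(0,\beta_1),\\ 1,&\beta\in(\beta_1,\beta_2),\\ -1,&\beta\in(\beta_2,1).\end{cases}$$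 The corresponding costate vector is, for $\tau\in(\tau_{i-1},\tau_i)$, $$p_1(\tau)=-\frac{p_0}{6}\prod_{k=1}^3\big(\tau-(1-\beta_k)\tau_{i-1}-\beta_k\tau_i\big),\quad p_2(\tau)=-\dot p_1(\tau),\quad p_3(\tau)=-\dot p_2(\tau),\quad (p_0,p_1,p_2,p_3)\ne0.$$
   Context: Problem (R): minimize $\widehat J=\int_0^\infty y_3(\tau)\,d\tau$ subject to $\dot y_3=y_2$, $\dot y_2=y_1$, $\dot y_1=v$, $y(0)=(1,0,0)=e_1$ (with $y=(y_1,y_2,y_3)$), $y_3(\tau)\ge0$ and $|v(\tau)|\le1$ for all $\tau\in(0,\infty)$. Costates: for an optimal solution, Pontryagin's principle with the state constraint $y_3\ge0$ gives a constant $p_0\ge0$, costates $p=(p_1,p_2,p_3)$ and a multiplier $\zeta\ge0$ with $\zeta y_3=0$, such that $(p_0,p(\tau))\ne0$; $\dot p_1=-p_2$, $\dot p_2=-p_3$, $\dot p_3=-p_0+\zeta$; the Hamiltonian $p_0y_3+p_1v+p_2y_1+p_3y_2-\zeta y_3$ is identically $0$ and is minimized over $v\in[-1,1]$ (so $v=-\mathrm{sgn}(p_1)$ where $p_1\neq0$); $p_1,p_2$ are continuous, and $p_3$ may jump only at junction times $\tau_1>0$, with $p_3(\tau_1^+)-p_3(\tau_1^-)\ge0$. A junction time is a time at which the constraint $y_3\ge0$ switches between active ($y_3=0$) and inactive ($y_3>0$). *)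

theory Defs
  imports "HOL-Analysis.Analysis"
begin

definition beta_system ::
  "real \<Rightarrow> real \<Rightarrow> real \<Rightarrow> real \<Rightarrow> real \<Rightarrow> real \<Rightarrow> bool" where
  "beta_system \<alpha> T Tinf \<beta>1 \<beta>2 \<beta>3 \<longleftrightarrow>
     0 < \<beta>1 \<and> \<beta>1 < \<beta>2 \<and> \<beta>2 < 1 \<and> 1 < \<beta>3 \<and> 0 < \<alpha> \<and> \<alpha> < 1 \<and> 0 < T \<and>
     (1 - 2 * (1 - \<beta>1) + 2 * (1 - \<beta>2)) * T = 1 - \<alpha> \<and>
     (1 - 2 * (1 - \<beta>1)^2 + 2 * (1 - \<beta>2)^2) * T = 2 \<and>
     (1 - 2 * (1 - \<beta>1)^3 + 2 * (1 - \<beta>2)^3) * T = 3 \<and>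
     2 * (\<beta>1 + \<beta>2 + \<beta>3) + (\<alpha>^2 - 1) * (\<beta>1 * \<beta>2 + \<beta>1 * \<beta>3 + \<beta>2 * \<beta>3) = 3 \<and>
     \<beta>1 + \<beta>2 + \<beta>3 - (\<beta>1 * \<beta>2 + \<beta>1 * \<beta>3 + \<beta>2 * \<beta>3) - \<beta>1 * \<beta>2 * \<beta>3 * (\<alpha>^3 - 1) = 1 \<and>
     Tinf = T / (1 - \<alpha>)"

(* Controls are measurable functions on the half-line, and each differential equation is
   understood in the Caratheodory sense: x' = f means x t - x 0 = integral of f over [0, t].
   Values at negative times are irrelevant throughout. *)
definition admissible :: "(real \<Rightarrow> real^3) \<Rightarrow> (real \<Rightarrow> real) \<Rightarrow> bool" where
  "admissible y v \<longleftrightarrow>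
     v \<in> borel_measurable (lebesgue_on {0..}) \<and>
     y 0 = axis 1 1 \<and>
     (\<forall>t\<ge>0. ((\<lambda>s. y s $ 2) has_integral (y t $ 3 - y 0 $ 3)) {0..t} \<and>
            ((\<lambda>s. y s $ 1) has_integral (y t $ 2 - y 0 $ 2)) {0..t} \<and>
            (v has_integral (y t $ 1 - y 0 $ 1)) {0..t}) \<and>
     (\<forall>t>0. y t $ 3 \<ge> 0 \<and> \<bar>v t\<bar> \<le> 1)"

(* The integrand is nonnegative for admissible y, so the cost lives in [0, \<infinity>]. *)
definition cost :: "(real \<Rightarrow> real^3) \<Rightarrow> ennreal" where
  "cost y = (\<integral>\<^sup>+t\<in>{0..}. ennreal (y t $ 3) \<partial>lborel)"

definition optimal :: "(real \<Rightarrow> real^3) \<Rightarrow> (real \<Rightarrow> real) \<Rightarrow> bool" where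
  "optimal y v \<longleftrightarrow> admissible y v \<and> (\<forall>y' v'. admissible y' v' \<longrightarrow> cost y \<le> cost y')"

(* The constraint is active at t and inactive immediately before or immediately after t.
   Contact points (inactive on both sides) count; a mere accumulation point of such times,
   with no inactive interval adjacent to it, does not. *)
definition junction_time :: "(real \<Rightarrow> real^3) \<Rightarrow> real \<Rightarrow> bool" where
  "junction_time y t \<longleftrightarrow>
     0 \<le> t \<and> y t $ 3 = 0 \<and>
     (\<exists>\<epsilon>>0. (\<forall>s\<in>{t<..<t + \<epsilon>}. y s $ 3 > 0) \<or>
            (\<epsilon> \<le> t \<and> (\<forall>s\<in>{t - \<epsilon><..<t}. y s $ 3 > 0)))"

definition hamiltonian ::
  "real \<Rightarrow> real^3 \<Rightarrow> real \<Rightarrow> real^3 \<Rightarrow> real \<Rightarrow> real" where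
  "hamiltonian p0 p \<zeta> y v = p0 * y $ 3 + p $ 1 * v + p $ 2 * y $ 1 + p $ 3 * y $ 2 - \<zeta> * y $ 3"

(* The costate equations for p1 and p2 hold on all of [0, \<infinity>), which makes p1 and p2 continuous.
   The equation for p3 holds on every interval without positive junction times; p3 is
   continuous at all other times (one-sidedly at 0) and has one-sided limits with a
   nonnegative jump at the positive junction times.
   Conditions involving v are for almost every t, v being determined only up to null sets. *)
definition costate_multiplier ::
  "(real \<Rightarrow> real^3) \<Rightarrow> (real \<Rightarrow> real) \<Rightarrow> real \<Rightarrow> (real \<Rightarrow> real^3) \<Rightarrow> (real \<Rightarrow> real) \<Rightarrow> bool" where
  "costate_multiplier y v p0 p \<zeta> \<longleftrightarrow>
     p0 \<ge> 0 \<and>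
     (\<forall>t\<ge>0. (p0, p t) \<noteq> 0) \<and>
     (\<forall>t>0. \<zeta> t \<ge> 0 \<and> \<zeta> t * y t $ 3 = 0) \<and>
     (\<forall>t\<ge>0. ((\<lambda>s. - p s $ 2) has_integral (p t $ 1 - p 0 $ 1)) {0..t} \<and>
            ((\<lambda>s. - p s $ 3) has_integral (p t $ 2 - p 0 $ 2)) {0..t}) \<and>
     (\<forall>a b. 0 \<le> a \<and> a \<le> b \<and> (\<forall>t\<in>{a..b}. t > 0 \<longrightarrow> \<not> junction_time y t) \<longrightarrow>
        ((\<lambda>s. - p0 + \<zeta> s) has_integral (p b $ 3 - p a $ 3)) {a..b}) \<and>
     (\<forall>t\<ge>0. \<not> (t > 0 \<and> junction_time y t) \<longrightarrow>
        continuous (at t within {0..}) (\<lambda>s. p s $ 3)) \<and>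
     (\<forall>t>0. junction_time y t \<longrightarrow>
        (\<exists>l r. ((\<lambda>s. p s $ 3) \<longlongrightarrow> l) (at_left t) \<and>
               ((\<lambda>s. p s $ 3) \<longlongrightarrow> r) (at_right t) \<and> r - l \<ge> 0)) \<and>
     (AE t in lebesgue. t > 0 \<longrightarrow>
        hamiltonian p0 (p t) (\<zeta> t) (y t) (v t) = 0 \<and>
        (\<forall>w\<in>{-1..1}. hamiltonian p0 (p t) (\<zeta> t) (y t) (v t) \<le> hamiltonian p0 (p t) (\<zeta> t) (y t) w))"

definition tau :: "real \<Rightarrow> real \<Rightarrow> nat \<Rightarrow> real" where
  "tau \<alpha> T i = (1 - \<alpha>^i) / (1 - \<alpha>) * T"

end

(* Put D = \<beta>2 - \<beta>1 and n = \<beta>1 + \<beta>2 - 1. The first three equations say that T and \<alpha> are rational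
   functions of D and n and that 3Dn^2 = 3D - 1 - D^3; eliminating \<beta>3 and n from the other two leaves
   one polynomial equation of degree 7 in D, with exactly one root in the range allowed by the
   inequalities.

   The candidate trajectory and costate are the polynomial pieces on [0, T], repeated with the
   scaling t -> \<alpha>t and extended by 0 beyond the accumulation point. Optimality is verified directly,
   without Pontryagin's principle: integrating by parts against the candidate costate p gives, for
   every admissible (y, v),
     integral (y3 - y3 star) = integral p1 (v - v star) + sum of jumps of p3 times y3 at the junctions,
   and all terms on the right are nonnegative. Equality forces v = v star almost everywhere wherever
   p1 is nonzero, hence uniqueness of the optimal trajectory. An arbitrary costate is cubic between
   junctions; the control forces zeros of p1 at the two switches, and the vanishing Hamiltonian at the
   left junction forces the third one. *)
theory Submission
  imports Defs
begin

text \<open>Problem (R) is invariant under t -> \<alpha> t, y_k -> \<alpha>^k y_k with v unchanged,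
  so after returning to a multiple of e1 the process can repeat itself on a smaller scale. The first
  three equations of the system say y(T) = \<alpha> e1, the last two say p2(T) = \<alpha>^2 p2(0)
  and p1(T) = \<alpha>^3 p1(0); p3 is left unmatched because it may jump at a junction. A single
  costate can certify global optimality because dynamics and cost are linear and the constraints
  convex. The obstacles are analytic. Infinitely many junctions accumulate at T / (1 - \<alpha>), so
  boundary terms are collected block by block and must vanish in the limit. Controls are merely
  measurable and bounded, so integration by parts has to cope with Lipschitz primitives. After the
  accumulation point only y3 enters the cost, so uniqueness there is claimed for y3 alone.\<close>

section \<open>The algebraic system\<close>

text \<open>With D and n as above, the resultant of the last two equations, reduced modulo the curve
  \<open>3Dn\<^sup>2 = 3D - 1 - D\<^sup>3\<close>, is this polynomial up to factors that cannot vanish.\<close>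

definition beta_poly :: "real \<Rightarrow> real" where
  "beta_poly D = 12*D^7 - 4*D^6 - 60*D^5 + 36*D^4 + 67*D^3 - 60*D^2 + 15*D - 1"

text \<open>The derivative \<open>g\<close> is positive on the range that
  \<open>beta_system_reduce\<close> extracts from the inequalities of the system.\<close>

lemma beta_poly_inj:
  assumes "384/1000 < x" "x < 1/2" "384/1000 < y" "y < 1/2" "beta_poly x = beta_poly y"
  shows "x = y"
proof -
  define g where "g z = 84*z^6 - 24*z^5 - 300*z^4 + 144*z^3 + 201*z^2 - 120*z + 15" for z :: real
  have der: "(beta_poly has_real_derivative g z) (at z)" for z
    unfolding beta_poly_def [abs_def] g_def by (auto intro!: derivative_eq_intros)
  have pos: "g z > 0" if "384/1000 < z" "z < 1/2" for z
  proof -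
    \<comment> \<open>Expanding \<open>g\<close> at the left end of the range leaves only the cubic
      and quartic coefficients negative. They are absorbed into the quadratic term as the factor
      \<open>A\<close>, which stays positive because \<open>w < 116/1000\<close>.\<close>
    define w where "w = z - 384/1000"
    have w: "0 < w" "w < 116/1000" using that by (auto simp: w_def)
    have "w\<^sup>2 < (116/1000)\<^sup>2" using w by (intro power_strict_mono) auto
    hence "w\<^sup>2 < 13456/1000000" by (simp add: power_divide)
    hence "5628621957/48828125 - 100415088/390625 * w - 500892/3125 * w^2 > 0"

    proof -
      have "100415088/390625 * w < 100415088/390625 * (116/1000)" using w(2) by simp
      moreover have "500892/3125 * w\<^sup>2 < 500892/3125 * (13456/1000000)" using \<open>w\<^sup>2 < 13456/1000000\<close> by simp
      ultimately show ?thesis by linarith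
    qed
    moreover define A where "A = 5628621957/48828125 - 100415088/390625 * w - 500892/3125 * w^2"
    ultimately have "w^2 * A > 0" using w(1) by simp
    moreover have "w^5 > 0" "w^6 > 0" using w by auto
    moreover have "g z = 84*w^6 + 21192/125*w^5 + w^2 * A
        + 968023084872/30517578125*w + 985466679351/3814697265625"
      unfolding g_def w_def A_def by (simp add: field_simps) algebra
    ultimately show ?thesis using w(1) by linarith
  qed
  have mono: "beta_poly a < beta_poly b" if "384/1000 < a" "a < b" "b < 1/2" for a b
    by (rule DERIV_pos_imp_increasing [OF that(2)]) (use der pos that in force)
  show ?thesis using mono[of x y] mono[of y x] assms by (cases x y rule: linorder_cases) auto
qed

text \<open>In these terms a solution has \<open>T = 2/P\<close> and \<open>\<alpha> = M/P\<close>,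
  while \<open>a\<close> and \<open>b\<close> are 4 times the products of the first two
  \<open>\<beta>\<close>s and of their complements to 1. The bracket is the fifth equation after
  elimination of \<open>\<beta>3\<close> and clearing of denominators. As an identity on the curve
  it works both ways: from a solution to a root and from a root to a solution.\<close>

lemma resultant_identity:
  fixes D n :: real
  assumes "3*D*n^2 = 3*D - 1 - D^3"
  defines "P \<equiv> 2*D*n + (1 - 2*D)" and "M \<equiv> 2*D*n - (1 - 2*D)"
    and "a \<equiv> (1 + n)^2 - D^2" and "b \<equiv> (1 - n)^2 - D^2"
  shows "9 * D * (b*(a + 4*(1 + n))*P^3 - 2*a*b*P^2 - a^2*M^3) = - 32 * beta_poly D * n * M"
proof -
  \<comment> \<open>Quotient of the division by the curve equation, found by computer algebra.\<close>
  define Q where "Q = -432*D^3*n^4 + 144*D^2*n^4 - 2592*D^3*n^3 + 1008*D^2*n^3 - 72*D*n^3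
     + 1008*D^5*n^2 - 336*D^4*n^2 - 1152*D^3*n^2 + 576*D^2*n^2 - 84*D*n^2
     + 2304*D^5*n - 1488*D^4*n - 5304*D^3*n + 5040*D^2*n - 1344*D*n + 96*n
     - 432*D^5 + 432*D^4 + 324*D^3 - 432*D^2 + 108*D"
  have "27 * D * (b*(a + 4*(1 + n))*P^3 - 2*a*b*P^2 - a^2*M^3) + 96 * beta_poly D * n * M
      = (3*D*n^2 - (3*D - 1 - D^3)) * Q"
    unfolding P_def M_def a_def b_def Q_def beta_poly_def by algebra
  thus ?thesis using assms(1) by simp
qed

text \<open>The left side minus the right side is, up to a factor, the Hamiltonian at the start of an
  interval. It is constant in time, but by the last two equations its value at the end
  of the interval is \<open>\<alpha>\<^sup>3\<close> times that value; so it is 0.\<close>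

lemma beta_system_hamiltonian:
  assumes "beta_system \<alpha> T Tinf \<beta>1 \<beta>2 \<beta>3"
  shows "T * (\<beta>1 * \<beta>2 * \<beta>3) = \<beta>1 * \<beta>2 + \<beta>1 * \<beta>3 + \<beta>2 * \<beta>3"
proof -
  define e2 where "e2 = \<beta>1 * \<beta>2 + \<beta>1 * \<beta>3 + \<beta>2 * \<beta>3"
  define e3 where "e3 = \<beta>1 * \<beta>2 * \<beta>3"
  \<comment> \<open>The elementary symmetric functions of the three numbers
    \<open>1 - \<beta>k\<close>. They describe p2 and p1 at the end of the interval as
    \<open>e2\<close> and \<open>e3\<close> do at its start.\<close>
  define f2 where "f2 = 3 - 2 * (\<beta>1 + \<beta>2 + \<beta>3) + e2"
  define f3 where "f3 = 1 - (\<beta>1 + \<beta>2 + \<beta>3) + e2 - e3"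
  note S = assms[unfolded beta_system_def]
  have f2: "f2 = \<alpha>^2 * e2" and f3: "f3 = - (\<alpha>^3 * e3)"
    using S unfolding f2_def f3_def e2_def e3_def by (auto simp: algebra_simps)
  \<comment> \<open>Conservation of the Hamiltonian over the interval, arranged so that the left
    sides of the first three equations survive as factors and can be replaced by their
    values.\<close>
  have "(e3 + f3) * T = f2 * ((1 - 2 * (1 - \<beta>1) + 2 * (1 - \<beta>2)) * T)
      - (3 - (\<beta>1 + \<beta>2 + \<beta>3)) * ((1 - 2 * (1 - \<beta>1)^2 + 2 * (1 - \<beta>2)^2) * T)
      + (1 - 2 * (1 - \<beta>1)^3 + 2 * (1 - \<beta>2)^3) * T"
    unfolding f2_def f3_def e2_def e3_def by algebra
  also have "\<dots> = f2 * (1 - \<alpha>) - (3 - (\<beta>1 + \<beta>2 + \<beta>3)) * 2 + 3"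
    using S by simp
  also have "\<dots> = e2 - \<alpha> * f2" unfolding f2_def by algebra
  finally have "(1 - \<alpha>^3) * (T * e3 - e2) = 0" unfolding f2 f3 by algebra
  moreover have "\<alpha>^3 < 1" using S by (intro power_less_one_iff[THEN iffD2]) auto
  ultimately show ?thesis unfolding e2_def e3_def by simp
qed

lemma beta_system_reduce:
  assumes "beta_system \<alpha> T Tinf \<beta>1 \<beta>2 \<beta>3"
  defines "D \<equiv> \<beta>2 - \<beta>1" and "n \<equiv> \<beta>1 + \<beta>2 - 1"
  defines "P \<equiv> 2*D*n + (1 - 2*D)" and "M \<equiv> 2*D*n - (1 - 2*D)"
  shows "384/1000 < D" "D < 1/2" "0 < n" "3*D*n^2 = 3*D - 1 - D^3" "beta_poly D = 0"
    "0 < P" "0 < M" "T = 2/P" "\<alpha> = M/P" "\<beta>3 * (\<beta>1 * \<beta>2 * T - (\<beta>1 + \<beta>2)) = \<beta>1 * \<beta>2"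
proof -
  note S = assms(1)[unfolded beta_system_def]
  define k where "k = 1 - 2*D"
  have D: "D > 0" using S by (simp add: D_def)
  have e1: "k * T = 1 - \<alpha>" and e2: "P * T = 2"
    using S unfolding k_def D_def n_def P_def by (auto simp: algebra_simps power2_eq_square)
  have "(1 - 2 * (1 - \<beta>1)^3 + 2 * (1 - \<beta>2)^3) = 1 - D * (3*(1-n)^2 + D^2) / 2"
    unfolding D_def n_def by (simp add: field_simps) algebra
  hence e3: "(1 - D * (3*(1-n)^2 + D^2) / 2) * T = 3" using S by metis
  have T: "T > 0" using S by simp
  show P: "0 < P" using e2 T by (metis zero_less_mult_pos2 zero_less_numeral)
  show T': "T = 2/P" using e2 P by (simp add: field_simps)
  have "\<alpha> * P = (1 - k * T) * P" using e1 by simp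
  also have "\<dots> = P - k * 2" unfolding T' using P by (simp add: field_simps)
  also have "\<dots> = M" unfolding k_def P_def M_def by simp
  finally have al: "\<alpha> * P = M" .
  thus "\<alpha> = M/P" using P by (simp add: field_simps)
  show M: "0 < M" using al P S by (metis mult_pos_pos)
  have k: "k > 0" using e1 T S by (metis diff_gt_0_iff_gt zero_less_mult_pos2)
  thus D2: "D < 1/2" by (simp add: k_def)
  have Dn: "2*D*n > k" using M by (simp add: M_def k_def)
  hence "2*D*n > 0" using k by linarith
  thus n: "n > 0" using D by (simp add: zero_less_mult_iff)
  have "(1 - D * (3*(1-n)^2 + D^2) / 2) * 2 = 3 * P"
    using e3 T P unfolding T' by (simp add: field_simps)
  thus curve: "3*D*n^2 = 3*D - 1 - D^3"
    unfolding P_def by (simp add: field_simps) algebra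
  \<comment> \<open>The condition \<open>\<alpha> > 0\<close> reads \<open>2*D*n > 1 - 2*D\<close>.
    After squaring, the curve equation removes \<open>n\<close> and leaves an inequality in
    \<open>D\<close> alone.\<close>
  have "k^2 < (2*D*n)^2" using Dn k by (intro power_strict_mono) auto
  moreover have "3 * (2*D*n)^2 = 4 * D * (3*D - 1 - D^3)"
    unfolding curve[symmetric] by (simp add: power2_eq_square)
  ultimately have "3 * k^2 < 4 * D * (3*D - 1 - D^3)" by linarith
  hence ineq: "8*D - 4*D^4 - 3 > 0"
    unfolding k_def by (simp add: power2_eq_square power3_eq_cube power4_eq_xxxx algebra_simps)
  moreover have "D^4 \<ge> 0" by simp
  ultimately have "D > 3/8" by linarith
  \<comment> \<open>The crude bound 3/8 is fed back once through the quartic term. This is needed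
    because the derivative of \<open>beta_poly\<close> is still slightly negative at 3/8.\<close>
  hence "D^4 > (3/8)^4" by (intro power_strict_mono) auto
  hence "D^4 > 81/4096" by (simp add: power_divide)
  thus D1: "384/1000 < D" using ineq by linarith
  note H = beta_system_hamiltonian[OF assms(1)]
  show b3: "\<beta>3 * (\<beta>1 * \<beta>2 * T - (\<beta>1 + \<beta>2)) = \<beta>1 * \<beta>2"
    using H by (simp add: algebra_simps)
  define a where "a = (1 + n)^2 - D^2"
  define b where "b = (1 - n)^2 - D^2"
  have a: "a = 4 * (\<beta>1 * \<beta>2)" and b: "b = 4 * ((1 - \<beta>1) * (1 - \<beta>2))"
    unfolding a_def b_def D_def n_def by algebra+
  have "a > 0" using a S by simp
  have "(1 - \<beta>1) * (1 - \<beta>2) * (\<beta>3 - 1) = \<alpha>^3 * (\<beta>1 * \<beta>2 * \<beta>3)"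
  proof -
    have "\<beta>1 + \<beta>2 + \<beta>3 - (\<beta>1 * \<beta>2 + \<beta>1 * \<beta>3 + \<beta>2 * \<beta>3)
        - \<beta>1 * \<beta>2 * \<beta>3 * (\<alpha>^3 - 1) = 1" using S by metis
    thus ?thesis by (simp add: algebra_simps)
  qed
  hence "(b * (\<beta>3 - 1)) * P^3 = (\<alpha>^3 * (a * \<beta>3)) * P^3" unfolding a b by simp
  hence r: "b * (\<beta>3 - 1) * P^3 = M^3 * a * \<beta>3" unfolding al[symmetric] power_mult_distrib by (simp add: ac_simps)
  have "\<beta>3 * (\<beta>1 * \<beta>2 * 2 - (1 + n) * P) = \<beta>1 * \<beta>2 * P"
    using b3 P unfolding T' n_def by (simp add: field_simps)
  hence b3': "\<beta>3 * (2 * a - 4 * (1 + n) * P) = a * P" unfolding a by (simp add: algebra_simps)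
  have "P * a * (b*(a + 4*(1 + n))*P^3 - 2*a*b*P^2 - a^2*M^3) = 0"
    using r b3' by algebra
  hence "b*(a + 4*(1 + n))*P^3 - 2*a*b*P^2 - a^2*M^3 = 0" using P \<open>a > 0\<close> by simp
  hence "- 32 * beta_poly D * n * M = 0"
    using resultant_identity[OF curve] unfolding a_def b_def P_def M_def by simp
  thus "beta_poly D = 0" using n M by simp
qed

text \<open>Injectivity of \<open>beta_poly\<close> fixes \<open>D\<close>, the curve fixes
  \<open>n^2\<close>, and \<open>n > 0\<close> selects the root. All other unknowns are functions of
  these two; for \<open>\<beta>3\<close> the coefficient in its linear equation is nonzero because
  the product is \<open>\<beta>1 * \<beta>2\<close>.\<close>

lemma beta_system_unique:
  assumes "beta_system \<alpha> T Tinf \<beta>1 \<beta>2 \<beta>3" "beta_system \<alpha>' T' Tinf' \<beta>1' \<beta>2' \<beta>3'"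
  shows "\<alpha>' = \<alpha> \<and> T' = T \<and> Tinf' = Tinf \<and> \<beta>1' = \<beta>1 \<and> \<beta>2' = \<beta>2 \<and> \<beta>3' = \<beta>3"
proof -
  note r = beta_system_reduce[OF assms(1)] and r' = beta_system_reduce[OF assms(2)]
  have D: "\<beta>2' - \<beta>1' = \<beta>2 - \<beta>1" by (rule beta_poly_inj) (use r r' in auto)
  have "(\<beta>1' + \<beta>2' - 1)^2 = (\<beta>1 + \<beta>2 - 1)^2" 
  proof -
    have "3 * (\<beta>2 - \<beta>1) * (\<beta>1' + \<beta>2' - 1)^2 = 3 * (\<beta>2 - \<beta>1) * (\<beta>1 + \<beta>2 - 1)^2"
      using r(4) r'(4) unfolding D by simp
    moreover have "3 * (\<beta>2 - \<beta>1) \<noteq> 0" using r(1) by simp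
    ultimately show ?thesis by (metis mult_left_cancel)
  qed
  hence n: "\<beta>1' + \<beta>2' - 1 = \<beta>1 + \<beta>2 - 1"
    by (rule power2_eq_imp_eq) (use r(3) r'(3) in linarith)+
  have b: "\<beta>1' = \<beta>1" "\<beta>2' = \<beta>2" using D n by auto
  have T: "T' = T" using r(8) r'(8) b by simp
  have al: "\<alpha>' = \<alpha>" using r(9) r'(9) b by simp
  have "\<beta>1 * \<beta>2 \<noteq> 0" using assms by (auto simp: beta_system_def)
  hence "\<beta>1 * \<beta>2 * T - (\<beta>1 + \<beta>2) \<noteq> 0" using r(10) by auto
  hence "\<beta>3' = \<beta>3" using trans[OF r'(10)[unfolded b T] r(10)[symmetric]] by simp
  thus ?thesis using b T al assms by (auto simp: beta_system_def)
qed

section \<open>Existence of the solution and its numerical enclosure\<close>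

lemma quotient_bounds:
  fixes x y :: real
  assumes "a \<le> x" "x \<le> b" "c \<le> y" "y \<le> d" "0 < a" "0 < c"
  shows "a / d \<le> x / y" "x / y \<le> b / c"
  using assms by (auto intro!: frac_le)

text \<open>Converse of \<open>beta_system_reduce\<close>. The values of \<open>T\<close>,
  \<open>al\<close>, \<open>b1\<close>, \<open>b2\<close> are the forced ones, and \<open>b3\<close>
  solves the relation of \<open>beta_system_hamiltonian\<close>, which is linear in it and has
  \<open>W\<close> as its scaled coefficient. At a root, \<open>resultant_identity\<close> then
  yields the fifth equation.\<close>

lemma beta_equations_of_root:
  fixes D n :: real
  assumes curve: "3*D*n^2 = 3*D - 1 - D^3" and root: "beta_poly D = 0" and D0: "D > 0"
  defines "P \<equiv> 2*D*n + (1 - 2*D)" and "M \<equiv> 2*D*n - (1 - 2*D)"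
    and "q \<equiv> ((1 + n)^2 - D^2) / 4"
  defines "W \<equiv> 2*q - (1 + n)*P"
  assumes P0: "P > 0" and M0: "M > 0" and W0: "W > 0"
  defines "T \<equiv> 2 / P" and "al \<equiv> M / P"
    and "b1 \<equiv> (1 + n - D) / 2" and "b2 \<equiv> (1 + n + D) / 2" and "b3 \<equiv> q * P / W"
  shows "(1 - 2 * (1 - b1) + 2 * (1 - b2)) * T = 1 - al"
    "(1 - 2 * (1 - b1)^2 + 2 * (1 - b2)^2) * T = 2"
    "(1 - 2 * (1 - b1)^3 + 2 * (1 - b2)^3) * T = 3"
    "2 * (b1 + b2 + b3) + (al^2 - 1) * (b1*b2 + b1*b3 + b2*b3) = 3"
    "b1 + b2 + b3 - (b1*b2 + b1*b3 + b2*b3) - b1*b2*b3 * (al^3 - 1) = 1"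
proof -
  have qb: "q = b1 * b2" unfolding q_def b1_def b2_def by (simp add: field_simps power2_eq_square)
  have TP: "T * P = 2" and alP: "al * P = M" using P0 by (simp_all add: T_def al_def)
  have T0: "T > 0" using P0 by (simp add: T_def)
  have E1: "(1 - 2 * (1 - b1) + 2 * (1 - b2)) * T = 1 - al"
  proof -
    have "1 - 2 * (1 - b1) + 2 * (1 - b2) = 1 - 2*D" unfolding b1_def b2_def by (simp add: field_simps)
    moreover have "(1 - 2*D) * T * P = (1 - al) * P"
    proof -
      have "(1 - 2*D) * T * P = (1 - 2*D) * 2" using TP by (simp add: mult.assoc)
      also have "\<dots> = P - M" unfolding P_def M_def by simp
      also have "\<dots> = (1 - al) * P" using alP by (simp add: algebra_simps)
      finally show ?thesis .
    qed
    ultimately show ?thesis using P0 by simp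
  qed
  have E2: "(1 - 2 * (1 - b1)^2 + 2 * (1 - b2)^2) * T = 2"
  proof -
    have "1 - 2 * (1 - b1)^2 + 2 * (1 - b2)^2 = P"
      unfolding b1_def b2_def P_def by (simp add: field_simps power2_eq_square)
    thus ?thesis using TP by (simp add: mult.commute)
  qed
  have E3: "(1 - 2 * (1 - b1)^3 + 2 * (1 - b2)^3) * T = 3"
  proof -
    have "2 * (1 - 2 * (1 - b1)^3 + 2 * (1 - b2)^3) = 2 - 3*D*(1-n)^2 - D^3"
      unfolding b1_def b2_def by (simp add: field_simps) algebra
    also have "\<dots> = 3 * P" using curve unfolding P_def by algebra
    finally show ?thesis using TP by algebra
  qed
  have b3W: "b3 * W = q * P" using W0 by (simp add: b3_def)
  have H: "T * (b1*b2*b3) = b1*b2 + b1*b3 + b2*b3"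
  proof -
    have "P * (T * (q*b3)) = P * (q + (1 + n)*b3)"
      using b3W TP unfolding W_def by algebra
    hence "T * (q*b3) = q + (1 + n)*b3" using P0 by simp
    moreover have "1 + n = b1 + b2" unfolding b1_def b2_def by (simp add: field_simps)
    ultimately have "T * (b1*b2*b3) = b1*b2 + (b1 + b2)*b3" unfolding qb by simp
    thus ?thesis by (simp add: algebra_simps)
  qed
  define X where "X = ((1 - n)^2 - D^2)*((1 + n)^2 - D^2 + 4*(1 + n))*P^3
    - 2*((1 + n)^2 - D^2)*((1 - n)^2 - D^2)*P^2 - ((1 + n)^2 - D^2)^2*M^3"
  have "9 * D * X = 0"
    unfolding X_def P_def M_def resultant_identity[OF curve] root by simp
  hence "X = 0" using D0 by simp
  moreover define g where "g = (1 - b1) * (1 - b2)"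
  moreover have "(1 - n)^2 - D^2 = 4 * g" "(1 + n)^2 - D^2 = 4 * q"
    unfolding g_def q_def b1_def b2_def by (simp_all add: field_simps power2_eq_square)
  ultimately have "4*g*(4*q + 4*(1 + n))*P^3 - 2*(4*q)*(4*g)*P^2 - (4*q)^2*M^3 = 0" unfolding X_def by simp
  hence R: "g * (q + (1 + n))*P^3 - 2*q*g*P^2 - q^2*M^3 = 0" by algebra
  have "P^2 * W * (g * (b3 - 1) * P - al^3 * q * b3 * P) = 0"
    using R b3W unfolding W_def alP[symmetric] by algebra
  hence g: "g * (b3 - 1) = al^3 * q * b3" using P0 W0 by simp
  have E5: "b1 + b2 + b3 - (b1*b2 + b1*b3 + b2*b3) - b1*b2*b3 * (al^3 - 1) = 1"
    using g unfolding g_def qb by algebra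
  \<comment> \<open>The conservation identity read backwards: with zero Hamiltonian at the start and
    the fifth equation known, what remains is the fourth equation times \<open>al\<close>.\<close>
  have E4: "2 * (b1 + b2 + b3) + (al^2 - 1) * (b1*b2 + b1*b3 + b2*b3) = 3"
  proof -
    define e2 where "e2 = b1*b2 + b1*b3 + b2*b3"
    define e3 where "e3 = b1*b2*b3"
    define f2 where "f2 = 3 - 2 * (b1 + b2 + b3) + e2"
    define f3 where "f3 = 1 - (b1 + b2 + b3) + e2 - e3"
    have "(e3 + f3) * T = f2 * ((1 - 2 * (1 - b1) + 2 * (1 - b2)) * T)
        - (3 - (b1 + b2 + b3)) * ((1 - 2 * (1 - b1)^2 + 2 * (1 - b2)^2) * T)
        + (1 - 2 * (1 - b1)^3 + 2 * (1 - b2)^3) * T"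
      unfolding f2_def f3_def e2_def e3_def by algebra
    also have "\<dots> = f2 * (1 - al) - (3 - (b1 + b2 + b3)) * 2 + 3"
      unfolding E1 E2 E3 by simp
    also have "\<dots> = e2 - al * f2" unfolding f2_def by algebra
    finally have "al * (f2 - al^2 * e2) = 0"
      using H E5 unfolding f3_def e2_def e3_def by algebra
    moreover have "al > 0" using M0 P0 by (simp add: al_def)
    ultimately have "f2 = al^2 * e2" by simp
    thus ?thesis unfolding f2_def e2_def by (simp add: algebra_simps)
  qed
  show "(1 - 2 * (1 - b1) + 2 * (1 - b2)) * T = 1 - al"
    "(1 - 2 * (1 - b1)^2 + 2 * (1 - b2)^2) * T = 2"
    "(1 - 2 * (1 - b1)^3 + 2 * (1 - b2)^3) * T = 3"
    "2 * (b1 + b2 + b3) + (al^2 - 1) * (b1*b2 + b1*b3 + b2*b3) = 3"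
    "b1 + b2 + b3 - (b1*b2 + b1*b3 + b2*b3) - b1*b2*b3 * (al^3 - 1) = 1"
    by fact+
qed

lemma beta_system_exists:
  "\<exists>\<alpha> T Tinf \<beta>1 \<beta>2 \<beta>3 :: real. beta_system \<alpha> T Tinf \<beta>1 \<beta>2 \<beta>3 \<and>
    \<bar>\<alpha> - 0.1660687\<bar> \<le> 5 / 10^8 \<and> \<bar>T - 4.2479105\<bar> \<le> 5 / 10^8 \<and>
    \<bar>Tinf - 5.0938372\<bar> \<le> 5 / 10^8 \<and> \<bar>\<beta>1 - 0.4698574\<bar> \<le> 5 / 10^8 \<and>
    \<bar>\<beta>2 - 0.8716996\<bar> \<le> 5 / 10^8 \<and> \<bar>\<beta>3 - 1.0283610\<bar> \<le> 5 / 10^8"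
proof -
  \<comment> \<open>Numerically computed brackets for the root \<open>D\<close> and for the
    corresponding \<open>n\<close>. They are certified by exact rational evaluation; everything
    after that is interval arithmetic on products and quotients.\<close>
  define l u nl nu :: real where "l = 0.4018421715972" and "u = 0.4018421715973"
    and "nl = 0.341557052213" and "nu = 0.3415570522145"
  note num = l_def u_def nl_def nu_def
  have "\<exists>x\<ge>l. x \<le> u \<and> beta_poly x = 0"
  proof (rule IVT)
    show "beta_poly l \<le> 0" "0 \<le> beta_poly u" unfolding beta_poly_def num by (simp_all add: field_simps)
    show "\<forall>x. l \<le> x \<and> x \<le> u \<longrightarrow> isCont beta_poly x"
      unfolding beta_poly_def [abs_def] by (auto intro!: continuous_intros)
  qed (simp add: num)
  then obtain D where D: "l \<le> D" "D \<le> u" "beta_poly D = 0" by blast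
  have D0: "D > 0" using D by (simp add: num)
  define X where "X = 1 - 1 / (3*D) - D^2/3"
  have "1 / (3*D) \<le> 1 / (3*l)" "1 / (3*u) \<le> 1 / (3*D)"
    using D D0 by (intro divide_left_mono; simp add: num)+
  moreover have "D^2 \<le> u^2" "l^2 \<le> D^2" by (intro power_mono; use D D0 in \<open>simp add: num power2_eq_square\<close>)+
  moreover have "nl^2 \<le> 1 - 1/(3*l) - u^2/3" "1 - 1/(3*u) - l^2/3 \<le> nu^2"
    unfolding num by (simp_all add: field_simps)
  ultimately have X: "nl^2 \<le> X" "X \<le> nu^2" unfolding X_def by linarith+
  define n where "n = sqrt X"
  have n: "nl \<le> n" "n \<le> nu"
    unfolding n_def by (rule real_le_rsqrt[OF X(1)], rule real_le_lsqrt) (use X in \<open>auto simp: num\<close>)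
  have n0: "n > 0" using n by (simp add: num)
  have "0 \<le> X" using X(1) zero_le_power2 order_trans by blast
  hence "n^2 = X" unfolding n_def by simp
  hence curve: "3*D*n^2 = 3*D - 1 - D^3"
    unfolding X_def using D0 by (simp add: field_simps power2_eq_square power3_eq_cube)
  define P where "P = 2*D*n + (1 - 2*D)"
  define M where "M = 2*D*n - (1 - 2*D)"
  have Dn: "l * nl \<le> D * n" "D * n \<le> u * nu"
    by (intro mult_mono; use D n D0 n0 in \<open>simp add: num power2_eq_square\<close>)+
  have P: "2*(l*nl) + 1 - 2*u \<le> P" "P \<le> 2*(u*nu) + 1 - 2*l"
    using Dn D unfolding P_def by (auto simp: mult.assoc)
  have M: "2*(l*nl) - 1 + 2*l \<le> M" "M \<le> 2*(u*nu) - 1 + 2*u"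
    using Dn D unfolding M_def by (auto simp: mult.assoc)
  have P0: "P > 0" using P(1) by (simp add: num)
  have M0: "M > 0" using M(1) by (simp add: num)
  have k: "1 - 2*u \<le> 1 - 2*D" "1 - 2*D \<le> 1 - 2*l" using D by auto
  have k0: "1 - 2*D > 0" using k(1) by (simp add: num)
  define T where "T = 2 / P"
  define al where "al = M / P"
  define b1 where "b1 = (1 + n - D) / 2"
  define b2 where "b2 = (1 + n + D) / 2"
  define q where "q = ((1 + n)^2 - D^2) / 4"
  have "(1 + nl)^2 \<le> (1 + n)^2" "(1 + n)^2 \<le> (1 + nu)^2" "l^2 \<le> D^2" "D^2 \<le> u^2"
    by (intro power_mono; use n D D0 n0 in \<open>simp add: num power2_eq_square\<close>)+
  hence q: "((1 + nl)^2 - u^2) / 4 \<le> q" "q \<le> ((1 + nu)^2 - l^2) / 4"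
    unfolding q_def by auto
  have q0: "q > 0" using q(1) by (simp add: num power2_eq_square)
  have sP: "(1 + nl) * (2*(l*nl) + 1 - 2*u) \<le> (1 + n) * P" "(1 + n) * P \<le> (1 + nu) * (2*(u*nu) + 1 - 2*l)"
    by (intro mult_mono; use n P P0 n0 in \<open>simp add: num power2_eq_square\<close>)+
  have qP: "((1 + nl)^2 - u^2) / 4 * (2*(l*nl) + 1 - 2*u) \<le> q * P"
      "q * P \<le> ((1 + nu)^2 - l^2) / 4 * (2*(u*nu) + 1 - 2*l)"
    by (intro mult_mono; use q P P0 q0 in \<open>simp add: num power2_eq_square\<close>)+
  define W where "W = 2 * q - (1 + n) * P"
  have W: "((1 + nl)^2 - u^2) / 2 - (1 + nu) * (2*(u*nu) + 1 - 2*l) \<le> W"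
      "W \<le> ((1 + nu)^2 - l^2) / 2 - (1 + nl) * (2*(l*nl) + 1 - 2*u)"
    using q sP unfolding W_def by linarith+
  have W0: "W > 0" using W(1) by (simp add: num power2_eq_square)
  define b3 where "b3 = q * P / W"
  have Tb: "\<bar>T - 4.2479105\<bar> \<le> 5 / 10^8"
  proof -
    have "2 / (2*(u*nu) + 1 - 2*l) \<le> T" "T \<le> 2 / (2*(l*nl) + 1 - 2*u)"
      unfolding T_def by (rule quotient_bounds[OF order_refl order_refl P]; simp add: num)+
    thus ?thesis by (simp add: num abs_le_iff field_simps)
  qed
  have alb: "\<bar>al - 0.1660687\<bar> \<le> 5 / 10^8"
  proof -
    have "(2*(l*nl) - 1 + 2*l) / (2*(u*nu) + 1 - 2*l) \<le> al" "al \<le> (2*(u*nu) - 1 + 2*u) / (2*(l*nl) + 1 - 2*u)"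
      unfolding al_def by (rule quotient_bounds[OF M P]; simp add: num)+
    thus ?thesis by (simp add: num abs_le_iff field_simps)
  qed
  \<comment> \<open>By the first equation \<open>1 - al = (1 - 2*D) * T\<close>, so
    \<open>Tinf\<close> depends on \<open>D\<close> alone.\<close>
  have Tib: "\<bar>1 / (1 - 2*D) - 5.0938372\<bar> \<le> 5 / 10^8"
  proof -
    have "1 / (1 - 2*l) \<le> 1 / (1 - 2*D)" "1 / (1 - 2*D) \<le> 1 / (1 - 2*u)"
      by (rule quotient_bounds[OF order_refl order_refl k]; simp add: num)+
    thus ?thesis by (simp add: num abs_le_iff field_simps)
  qed
  have b12: "\<bar>b1 - 0.4698574\<bar> \<le> 5 / 10^8" "\<bar>b2 - 0.8716996\<bar> \<le> 5 / 10^8"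
    using D n unfolding b1_def b2_def num by (auto simp: abs_le_iff)
  have b3b: "\<bar>b3 - 1.0283610\<bar> \<le> 5 / 10^8"
  proof -
    note B = quotient_bounds[OF qP W, folded b3_def]
    have "b3 \<le> 1.02836105" by (rule order_trans[OF B(2)]) (simp_all add: num power2_eq_square)
    moreover have "1.02836095 \<le> b3" by (rule order_trans[OF _ B(1)]) (simp_all add: num power2_eq_square)
    ultimately show ?thesis unfolding abs_le_iff by simp
  qed
  note E = beta_equations_of_root[OF curve D(3) D0 P0[unfolded P_def] M0[unfolded M_def]
      W0[unfolded W_def q_def P_def],
      folded P_def M_def, folded q_def, folded W_def, folded T_def al_def b1_def b2_def b3_def]
  have T0: "T > 0" using P0 by (simp add: T_def)
  have "T / (1 - al) = 1 / (1 - 2*D)"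
  proof -
    have "1 - al = (1 - 2*D) * T" unfolding E(1)[symmetric] b1_def b2_def by (simp add: field_simps)
    thus ?thesis using T0 k0 by simp
  qed
  moreover have "0 < b1" "b1 < b2" "b2 < 1" "1 < b3" "0 < al" "al < 1"
    using alb b12 b3b unfolding abs_le_iff by simp_all
  ultimately have "beta_system al T (1 / (1 - 2*D)) b1 b2 b3"
    using E T0 unfolding beta_system_def by simp
  with Tb alb Tib b12 b3b show ?thesis by blast
qed

section \<open>Self-similar functions\<close>

definition block :: "real \<Rightarrow> real \<Rightarrow> real \<Rightarrow> nat" where
  "block \<alpha> T t = (LEAST i. t < tau \<alpha> T (Suc i))"

text \<open>Copy number i of \<open>F\<close>, shrunk in time by \<open>\<alpha>^i\<close> and
  multiplied by \<open>c^i\<close>. The outer test also keeps \<open>block\<close> away from times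
  at which no index satisfies its condition.\<close>

definition selfsim :: "real \<Rightarrow> real \<Rightarrow> real \<Rightarrow> (real \<Rightarrow> real) \<Rightarrow> real \<Rightarrow> real" where
  "selfsim \<alpha> T c F t = (if t < T / (1 - \<alpha>)
     then c ^ block \<alpha> T t * F ((t - tau \<alpha> T (block \<alpha> T t)) / \<alpha> ^ block \<alpha> T t) else 0)"

locale scaling =
  fixes \<alpha> T :: real
  assumes \<alpha>: "0 < \<alpha>" "\<alpha> < 1" and T: "0 < T"
begin

abbreviation "\<tau> \<equiv> tau \<alpha> T"
abbreviation "\<tau>inf \<equiv> T / (1 - \<alpha>)"

lemma tau_0 [simp]: "\<tau> 0 = 0"
  by (simp add: tau_def)

lemma tau_Suc: "\<tau> (Suc i) = \<tau> i + \<alpha>^i * T"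
  using \<alpha> unfolding tau_def by (simp add: field_simps)

lemma tau_alt: "\<tau> i = \<tau>inf - \<alpha>^i * \<tau>inf"
  unfolding tau_def by (simp add: left_diff_distrib diff_divide_distrib)

lemma tau_strict_mono: "strict_mono \<tau>"
  by (rule strict_monoI_Suc) (use \<alpha> T in \<open>simp add: tau_Suc\<close>)

lemma tau_less_iff [simp]: "\<tau> i < \<tau> j \<longleftrightarrow> i < j"
  using tau_strict_mono by (rule strict_mono_less)

lemma tau_le_iff [simp]: "\<tau> i \<le> \<tau> j \<longleftrightarrow> i \<le> j"
  using tau_strict_mono by (rule strict_mono_less_eq)

lemma tau_nonneg [simp]: "0 \<le> \<tau> i"
  using tau_le_iff[of 0 i] by simp

lemma tau_inf_pos: "0 < \<tau>inf"
  using \<alpha> T by simp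

lemma tau_less_inf: "\<tau> i < \<tau>inf"
  using mult_pos_pos[OF zero_less_power[OF \<alpha>(1), of i] tau_inf_pos] unfolding tau_alt by linarith

lemma tau_tendsto: "\<tau> \<longlonglongrightarrow> \<tau>inf"
proof -
  have "(\<lambda>i. \<tau>inf - \<alpha>^i * \<tau>inf) \<longlonglongrightarrow> \<tau>inf - 0 * \<tau>inf"
    using \<alpha> by (intro tendsto_intros LIMSEQ_realpow_zero) auto
  thus ?thesis by (simp add: tau_alt [abs_def])
qed

lemma ex_tau_greater:
  assumes "t < \<tau>inf"
  shows "\<exists>i. t < \<tau> i"
  using order_tendstoD(1)[OF tau_tendsto assms] by (auto simp: eventually_sequentially)

lemma block_eq:
  assumes "\<tau> i \<le> t" "t < \<tau> (Suc i)"
  shows "block \<alpha> T t = i"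
  unfolding block_def
proof (rule Least_equality)
  fix j assume "t < \<tau> (Suc j)"
  hence "\<tau> i < \<tau> (Suc j)" using assms by linarith
  thus "i \<le> j" by simp
qed (use assms in auto)

lemma in_block:
  assumes "0 \<le> t" "t < \<tau>inf"
  obtains i where "\<tau> i \<le> t" "t < \<tau> (Suc i)"
proof -
  obtain k where "t < \<tau> k" using ex_tau_greater[OF assms(2)] by blast
  moreover define m where "m = (LEAST k. t < \<tau> k)"
  ultimately have m: "t < \<tau> m" and min: "\<And>j. j < m \<Longrightarrow> \<not> t < \<tau> j"
    by (auto intro: LeastI dest: not_less_Least)
  have "m \<noteq> 0" using m assms(1) by (cases m) auto
  then obtain i where "m = Suc i" by (cases m) auto
  with m min[of i] show ?thesis by (intro that[of i]) auto
qed

lemma selfsim_block: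
  assumes "\<tau> i \<le> t" "t < \<tau> (Suc i)"
  shows "selfsim \<alpha> T c F t = c^i * F ((t - \<tau> i) / \<alpha>^i)"
  using assms tau_less_inf[of "Suc i"] unfolding selfsim_def by (simp add: block_eq)

lemma selfsim_beyond [simp]: "\<tau>inf \<le> t \<Longrightarrow> selfsim \<alpha> T c F t = 0"
  by (simp add: selfsim_def)

lemma selfsim_tau [simp]: "selfsim \<alpha> T c F (\<tau> i) = c^i * F 0"
  by (subst selfsim_block[of i]) auto

lemma selfsim_0 [simp]: "selfsim \<alpha> T c F 0 = F 0"
  using selfsim_tau[of c F 0] by simp

text \<open>The hypothesis \<open>F T = c * F 0\<close> is what glues consecutive copies
  continuously, so the formula of a block also holds at its right end.\<close>

lemma selfsim_closed_block:
  assumes "F T = c * F 0" "\<tau> i \<le> t" "t \<le> \<tau> (Suc i)"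
  shows "selfsim \<alpha> T c F t = c^i * F ((t - \<tau> i) / \<alpha>^i)"
proof (cases "t = \<tau> (Suc i)")
  case True
  thus ?thesis using assms(1) \<alpha> by (subst True, subst selfsim_tau) (simp add: tau_Suc True)
qed (use assms selfsim_block in force)

lemma rescaled_bounds:
  assumes "\<tau> i \<le> t" "t \<le> \<tau> (Suc i)"
  shows "0 \<le> (t - \<tau> i) / \<alpha>^i" "(t - \<tau> i) / \<alpha>^i \<le> T"
  using assms \<alpha> by (auto simp: tau_Suc field_simps)

lemma rescaled_bounds_strict:
  assumes "\<tau> i < t" "t < \<tau> (Suc i)"
  shows "0 < (t - \<tau> i) / \<alpha>^i" "(t - \<tau> i) / \<alpha>^i < T"
  using assms \<alpha> by (auto simp: tau_Suc field_simps)

lemma selfsim_bound: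
  assumes "\<And>x. 0 \<le> x \<Longrightarrow> x \<le> T \<Longrightarrow> \<bar>G x\<bar> \<le> M" "0 \<le> d" "d \<le> 1" "0 \<le> t"
  shows "\<bar>selfsim \<alpha> T d G t\<bar> \<le> M"
proof (cases "t < \<tau>inf")
  case True
  then obtain i where i: "\<tau> i \<le> t" "t < \<tau> (Suc i)" using in_block assms(4) by blast
  have "\<bar>selfsim \<alpha> T d G t\<bar> = d^i * \<bar>G ((t - \<tau> i) / \<alpha>^i)\<bar>"
    using assms by (simp add: selfsim_block[OF i] abs_mult)
  also have "\<dots> \<le> 1 * M"
    using rescaled_bounds[of i t] i assms by (intro mult_mono power_le_one) auto
  finally show ?thesis by simp
next
  case False
  have "0 \<le> M" using assms(1)[of 0] T by linarith
  thus ?thesis using False by simp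
qed

text \<open>The chain rule divides the ratio of the copies by \<open>\<alpha>\<close>, whence
  \<open>c = d * \<alpha>\<close>. The increments telescope over complete blocks, and since
  \<open>\<bar>c\<bar> < 1\<close> the boundary values tend to 0 at \<open>\<tau>inf\<close>. The
  set \<open>S\<close> is for the switching times, and \<open>d = 1\<close> is the case of the
  control.\<close>

lemma selfsim_has_integral:
  assumes F: "continuous_on {0..T} F" "F T = c * F 0"
    and fin: "finite S" and der: "\<And>x. 0 < x \<Longrightarrow> x < T \<Longrightarrow> x \<notin> S \<Longrightarrow> (F has_real_derivative G x) (at x)"
    and bound: "\<And>x. 0 \<le> x \<Longrightarrow> x \<le> T \<Longrightarrow> \<bar>G x\<bar> \<le> M"
    and d: "c = d * \<alpha>" "0 \<le> d" "d \<le> 1" and t: "0 \<le> t"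
  shows "(selfsim \<alpha> T d G has_integral selfsim \<alpha> T c F t - F 0) {0..t}"
proof -
  have piece: "(selfsim \<alpha> T d G has_integral selfsim \<alpha> T c F t - c^i * F 0) {\<tau> i..t}"
    if t: "\<tau> i \<le> t" "t \<le> \<tau> (Suc i)" for i t
  proof -
    define f where "f s = c^i * F ((s - \<tau> i) / \<alpha>^i)" for s
    define f' where "f' s = d^i * G ((s - \<tau> i) / \<alpha>^i)" for s
    have "(f' has_integral (f t - f (\<tau> i))) {\<tau> i..t}"
    proof (rule fundamental_theorem_of_calculus_interior_strong)
      show "finite ((\<lambda>x. \<tau> i + \<alpha>^i * x) ` S)" using fin by simp
      show "continuous_on {\<tau> i..t} f" unfolding f_def
        by (intro continuous_intros continuous_on_compose2[OF F(1)])
          (use t \<alpha> in \<open>auto simp: tau_Suc field_simps\<close>)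
      fix s assume s: "s \<in> {\<tau> i<..<t} - (\<lambda>x. \<tau> i + \<alpha>^i * x) ` S"
      have "(s - \<tau> i) / \<alpha>^i \<notin> S"
      proof
        assume "(s - \<tau> i) / \<alpha>^i \<in> S"
        hence "\<tau> i + \<alpha>^i * ((s - \<tau> i) / \<alpha>^i) \<in> (\<lambda>x. \<tau> i + \<alpha>^i * x) ` S" by blast
        thus False using s \<alpha> by simp
      qed
      hence "(F has_real_derivative G ((s - \<tau> i) / \<alpha>^i)) (at ((s - \<tau> i) / \<alpha>^i))"
        using rescaled_bounds_strict[of i s] s t by (intro der) auto
      moreover have "((\<lambda>s. (s - \<tau> i) / \<alpha>^i) has_real_derivative 1 / \<alpha>^i) (at s)"
        using \<alpha> by (auto intro!: derivative_eq_intros)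
      ultimately have "((\<lambda>s. F ((s - \<tau> i) / \<alpha>^i)) has_real_derivative G ((s - \<tau> i) / \<alpha>^i) * (1 / \<alpha>^i)) (at s)"
        by (rule DERIV_chain2)
      hence "(f has_real_derivative c^i * (G ((s - \<tau> i) / \<alpha>^i) * (1 / \<alpha>^i))) (at s)"
        unfolding f_def by (rule DERIV_cmult)
      moreover have "c^i * (G ((s - \<tau> i) / \<alpha>^i) * (1 / \<alpha>^i)) = f' s"
        using \<alpha> unfolding f'_def d power_mult_distrib by simp
      ultimately show "(f has_vector_derivative f' s) (at s)"
        by (simp add: has_real_derivative_iff_has_vector_derivative)
    qed (use t in auto)
    moreover have "f t = selfsim \<alpha> T c F t" unfolding f_def using selfsim_closed_block[of F c i t] F t by simp
    moreover have "f (\<tau> i) = c^i * F 0" by (simp add: f_def)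
    ultimately have "(f' has_integral (selfsim \<alpha> T c F t - c^i * F 0)) {\<tau> i..t}" by simp
    \<comment> \<open>At \<open>t = \<tau> (Suc i)\<close> the self-similar integrand already takes
      its value from the next copy, and no matching is assumed for \<open>G\<close>; hence the
      single point \<open>t\<close> is discarded.\<close>
    thus ?thesis
    proof (rule has_integral_spike_finite[of "{t}", rotated 2])
      fix s assume "s \<in> {\<tau> i..t} - {t}"
      thus "selfsim \<alpha> T d G s = f' s" using t unfolding f'_def by (intro selfsim_block) auto
    qed simp
  qed
  have up: "(selfsim \<alpha> T d G has_integral c^N * F 0 - F 0) {0..\<tau> N}" for N
  proof (induction N)
    case (Suc N)
    have "(selfsim \<alpha> T d G has_integral c^Suc N * F 0 - c^N * F 0) {\<tau> N..\<tau> (Suc N)}"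
      using piece[of N "\<tau> (Suc N)"] by simp
    from has_integral_combine[OF _ _ Suc.IH this] show ?case by simp
  qed (simp add: has_integral_refl)
  have fin_case: "(selfsim \<alpha> T d G has_integral selfsim \<alpha> T c F t - F 0) {0..t}"
    if t: "0 \<le> t" "t < \<tau>inf" for t
  proof -
    obtain i where i: "\<tau> i \<le> t" "t < \<tau> (Suc i)" using in_block t by blast
    from has_integral_combine[OF _ i(1) up[of i] piece[of i t]] i show ?thesis by simp
  qed
  have c1: "\<bar>c\<bar> < 1"
  proof -
    have "d * \<alpha> \<le> 1 * \<alpha>" using d \<alpha> by (intro mult_right_mono) auto
    moreover have "0 \<le> d * \<alpha>" using d \<alpha> by simp
    ultimately show ?thesis using \<alpha>(2) unfolding d(1) by linarith
  qed
  have inf_case: "(selfsim \<alpha> T d G has_integral - F 0) {0..\<tau>inf}"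
  proof -
    \<comment> \<open>Truncations at the junctions, dominated by the constant \<open>M\<close>. They
      converge at \<open>s = \<tau>inf\<close> too, where they and the limit are all 0.\<close>
    define g where "g N s = (if s \<in> {0..\<tau> N} then selfsim \<alpha> T d G s else 0)" for N s
    have sub: "{0..\<tau> N} \<subseteq> {0..\<tau>inf}" for N using tau_less_inf[of N] by auto
    have gi: "(g N has_integral c^N * F 0 - F 0) {0..\<tau>inf}" for N
      unfolding g_def has_integral_restrict[OF sub] by (rule up)
    have M: "0 \<le> M" using bound[of 0] T by linarith
    have conv: "(\<lambda>N. g N s) \<longlonglongrightarrow> selfsim \<alpha> T d G s" if s: "s \<in> {0..\<tau>inf}" for s
    proof (cases "s = \<tau>inf")
      case False
      hence "eventually (\<lambda>N. s < \<tau> N) sequentially"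
        using s by (intro order_tendstoD(1)[OF tau_tendsto]) auto
      hence "eventually (\<lambda>N. g N s = selfsim \<alpha> T d G s) sequentially"
        by eventually_elim (use s in \<open>auto simp: g_def\<close>)
      thus ?thesis by (rule tendsto_eventually)
    next
      case True
      hence "g N s = 0" for N by (simp add: g_def)
      thus ?thesis using True by simp
    qed
    have "\<And>N. g N integrable_on {0..\<tau>inf}" using gi by blast
    moreover have "(\<lambda>_. M) integrable_on {0..\<tau>inf}" by (rule integrable_const_ivl)
    moreover have "\<And>N s. s \<in> {0..\<tau>inf} \<Longrightarrow> norm (g N s) \<le> M"
      using selfsim_bound[OF bound d(2,3)] M by (auto simp: g_def)
    ultimately have dc: "selfsim \<alpha> T d G integrable_on {0..\<tau>inf}"
        "(\<lambda>N. integral {0..\<tau>inf} (g N)) \<longlonglongrightarrow> integral {0..\<tau>inf} (selfsim \<alpha> T d G)"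
      using dominated_convergence[of g "{0..\<tau>inf}" "\<lambda>_. M" "selfsim \<alpha> T d G"] conv by blast+
    have "(\<lambda>N. c^N * F 0 - F 0) \<longlonglongrightarrow> 0 * F 0 - F 0"
      using c1 by (intro tendsto_intros LIMSEQ_power_zero) auto
    moreover have "integral {0..\<tau>inf} (g N) = c^N * F 0 - F 0" for N
      using gi by (rule integral_unique)
    ultimately have "integral {0..\<tau>inf} (selfsim \<alpha> T d G) = - F 0"
      using dc(2) by (auto intro: LIMSEQ_unique)
    thus ?thesis using dc(1) by (simp add: has_integral_iff)
  qed
  show ?thesis
  proof (cases "t < \<tau>inf")
    case False
    have "((\<lambda>_. 0) has_integral 0) {\<tau>inf..t}" by simp
    hence "(selfsim \<alpha> T d G has_integral 0) {\<tau>inf..t}"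
      by (rule has_integral_eq[rotated]) simp
    from has_integral_combine[OF _ _ inf_case this] False tau_inf_pos show ?thesis by simp
  qed (use fin_case t in auto)
qed

end

section \<open>Integration by parts against bounded controls\<close>

text \<open>Every difference quotient is at most \<open>C\<close> times the distance of the two
  points, so \<open>g\<close> has derivative 0 throughout.\<close>

lemma quadratic_modulus_imp_constant:
  fixes g :: "real \<Rightarrow> real"
  assumes "a \<le> b" and quad: "\<And>s t. a \<le> s \<Longrightarrow> s \<le> t \<Longrightarrow> t \<le> b \<Longrightarrow> \<bar>g t - g s\<bar> \<le> C * (t - s)\<^sup>2"
  shows "g b = g a"
proof -
  have "(g has_field_derivative 0) (at x within {a..b})" if x: "x \<in> {a..b}" for x
    unfolding has_field_derivative_iff
  proof (rule Lim_null_comparison)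
    have "norm ((g y - g x) / (y - x)) \<le> C * \<bar>y - x\<bar>" if y: "y \<in> {a..b}" "y \<noteq> x" for y
    proof -
      have "\<bar>g y - g x\<bar> \<le> C * (y - x)\<^sup>2"
        using quad[of x y] quad[of y x] x y
        by (cases "x \<le> y") (auto simp: abs_minus_commute power2_commute)
      also have "\<dots> = C * \<bar>y - x\<bar> * \<bar>y - x\<bar>" by (simp add: power2_eq_square abs_mult_self_eq)
      finally show ?thesis using y by (simp add: divide_le_eq abs_divide)
    qed
    thus "\<forall>\<^sub>F y in at x within {a..b}. norm ((g y - g x) / (y - x)) \<le> C * \<bar>y - x\<bar>"
      unfolding eventually_at_filter by (auto intro: always_eventually)
    have "((\<lambda>y. C * \<bar>y - x\<bar>) \<longlongrightarrow> C * \<bar>x - x\<bar>) (at x within {a..b})"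
      by (intro tendsto_intros)
    thus "((\<lambda>y. C * \<bar>y - x\<bar>) \<longlongrightarrow> 0) (at x within {a..b})" by simp
  qed
  then obtain c where "\<forall>x\<in>{a..b}. g x = c"
    using has_field_derivative_zero_constant[of "{a..b}" g] by auto
  thus ?thesis using assms(1) by simp
qed

text \<open>A gauge integrable function with a constant bound is absolutely integrable. The absolute
  form is kept because \<open>AE_zero_of_nonneg_integral_zero\<close> asks for it.\<close>

lemma product_integrable:
  fixes f g :: "real \<Rightarrow> real"
  assumes "continuous_on {a..b} f" "g integrable_on {a..b}" "\<And>t. t \<in> {a..b} \<Longrightarrow> \<bar>g t\<bar> \<le> B"
  shows "(\<lambda>t. f t * g t) absolutely_integrable_on {a..b}"
proof -
  have "g absolutely_integrable_on {a..b}"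
    by (rule absolutely_integrable_integrable_bound[of _ _ "\<lambda>_. B"])
      (use assms in \<open>auto intro: integrable_const_ivl\<close>)
  moreover have "bounded (f ` {a..b})"
    by (intro compact_imp_bounded compact_continuous_image assms compact_Icc)
  ultimately show ?thesis using assms(1)
    by (intro absolutely_integrable_bounded_measurable_product_real continuous_imp_measurable_on_sets_lebesgue) auto
qed

text \<open>The classical product rule is out of reach when \<open>v\<close> is a measurable
  control, whose primitive \<open>V\<close> is merely Lipschitz.\<close>

lemma integration_by_parts_bounded:
  fixes f f' v V :: "real \<Rightarrow> real"
  assumes ab: "a \<le> b"
    and der: "\<And>t. t \<in> {a..b} \<Longrightarrow> (f has_real_derivative f' t) (at t within {a..b})"
    and cont: "continuous_on {a..b} f'"
    and V: "\<And>t. t \<in> {a..b} \<Longrightarrow> (v has_integral V t - V a) {a..t}"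
    and bound: "\<And>t. t \<in> {a..b} \<Longrightarrow> \<bar>v t\<bar> \<le> B"
  shows "((\<lambda>t. f t * v t) has_integral f b * V b - f a * V a - integral {a..b} (\<lambda>t. f' t * V t)) {a..b}"
proof -
  obtain K where K: "\<And>t. t \<in> {a..b} \<Longrightarrow> \<bar>f' t\<bar> \<le> K"
    using compact_imp_bounded[OF compact_continuous_image[OF cont compact_Icc]]
    unfolding bounded_iff real_norm_def by fast
  have K0: "0 \<le> K" using K[of a] ab by force
  have B0: "0 \<le> B" using bound[of a] ab by force
  have vint: "(v has_integral V t - V s) {s..t}" if "a \<le> s" "s \<le> t" "t \<le> b" for s t
  proof -
    have "v integrable_on {s..t}"
      by (rule integrable_subinterval_real[of v a b]) (use V[of b] ab that in auto)
    moreover have "(v has_integral V s - V a) {a..s}" "(v has_integral V t - V a) {a..t}"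
      using V that by auto
    moreover have "integral {a..s} v + integral {s..t} v = integral {a..t} v"
      by (rule Henstock_Kurzweil_Integration.integral_combine) (use V[of t] that in auto)
    ultimately show ?thesis by (simp add: has_integral_iff)
  qed
  have VL: "\<bar>V t - V s\<bar> \<le> B * (t - s)" if "a \<le> s" "s \<le> t" "t \<le> b" for s t
    using has_integral_bound_real[OF B0 _ vint[OF that], of "{}"] bound that by simp
  have fL: "\<bar>f t - f s\<bar> \<le> K * (t - s)" if "a \<le> s" "s \<le> t" "t \<le> b" for s t
  proof -
    have "norm (f t - f s) \<le> K * norm (t - s)"
      by (rule field_differentiable_bound[of "{a..b}" f f']) (use der K that in auto)
    thus ?thesis using that by simp
  qed
  have contf: "continuous_on {a..b} f"
    using der by (intro DERIV_continuous_on) auto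
  have contV: "continuous_on {a..b} V"
  proof (rule lipschitz_on_continuous_on[OF lipschitz_onI])
    show "dist (V s) (V t) \<le> B * dist s t" if "s \<in> {a..b}" "t \<in> {a..b}" for s t
      using VL[of s t] VL[of t s] that by (cases "s \<le> t") (auto simp: dist_real_def abs_minus_commute)
  qed (rule B0)
  have "v integrable_on {a..b}" using V[of b] ab by auto
  hence fv: "(\<lambda>t. f t * v t) integrable_on {a..b}"
    by (rule set_lebesgue_integral_eq_integral(1)[OF product_integrable[OF contf _ bound]])
  have f'V: "(\<lambda>t. f' t * V t) integrable_on {a..b}"
    by (intro integrable_continuous_real continuous_intros cont contV)
  define g where "g t = integral {a..t} (\<lambda>u. f u * v u) - f t * V t + integral {a..t} (\<lambda>u. f' u * V u)" for t
  \<comment> \<open>\<open>V\<close> need not be differentiable, but both error terms of the product rule are quadratic.\<close>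
  have "g b = g a"
  proof (rule quadratic_modulus_imp_constant[OF ab])
    fix s t assume st: "a \<le> s" "s \<le> t" "t \<le> b"
    define X where "X = integral {s..t} (\<lambda>u. f u * v u)"
    define Y where "Y = integral {s..t} (\<lambda>u. f' u * V u)"
    have sub: "{a..t} \<subseteq> {a..b}" "{s..t} \<subseteq> {a..b}" using st by auto
    have X: "((\<lambda>u. f u * v u) has_integral X) {s..t}"
      unfolding X_def by (intro integrable_integral integrable_subinterval_real[OF fv sub(2)])
    have Y: "((\<lambda>u. f' u * V u) has_integral Y) {s..t}"
      unfolding Y_def by (intro integrable_integral integrable_subinterval_real[OF f'V sub(2)])
    have "integral {a..s} (\<lambda>u. f u * v u) + X = integral {a..t} (\<lambda>u. f u * v u)"
      "integral {a..s} (\<lambda>u. f' u * V u) + Y = integral {a..t} (\<lambda>u. f' u * V u)"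
      unfolding X_def Y_def using st
      by (intro Henstock_Kurzweil_Integration.integral_combine integrable_subinterval_real[OF fv sub(1)]
          integrable_subinterval_real[OF f'V sub(1)]; simp)+
    hence eq: "g t - g s = X + Y + f s * V s - f t * V t" unfolding g_def by linarith
    \<comment> \<open>The increment of \<open>f * V\<close> is
      \<open>f s * (V t - V s) + (f t - f s) * V t\<close>: \<open>f\<close> is frozen at the left
      end and \<open>V\<close> at the right end. Each error is an integral over length
      \<open>t - s\<close> of a product with one factor of order \<open>t - s\<close>.\<close>
    have "((\<lambda>u. f u * v u - f s * v u) has_integral X - f s * (V t - V s)) {s..t}"
      by (intro has_integral_diff X has_integral_mult_right vint st)
    hence I1: "((\<lambda>u. (f u - f s) * v u) has_integral X - f s * (V t - V s)) {s..t}"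
      by (simp add: left_diff_distrib)
    have "(f has_vector_derivative f' u) (at u within {s..t})" if "u \<in> {s..t}" for u
      unfolding has_real_derivative_iff_has_vector_derivative[symmetric]
      by (rule DERIV_subset[OF der]) (use that sub in auto)
    hence "(f' has_integral f t - f s) {s..t}"
      by (rule fundamental_theorem_of_calculus[OF st(2)])
    hence "((\<lambda>u. f' u * V u - f' u * V t) has_integral Y - (f t - f s) * V t) {s..t}"
      by (intro has_integral_diff Y has_integral_mult_left)
    hence I2: "((\<lambda>u. f' u * (V u - V t)) has_integral Y - (f t - f s) * V t) {s..t}"
      by (simp add: right_diff_distrib)
    have B1: "norm ((f u - f s) * v u) \<le> K * (t - s) * B" if "u \<in> {s..t} - {}" for u
    proof -
      have "\<bar>f u - f s\<bar> \<le> K * (t - s)"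
        using fL[of s u] that st K0 by (auto intro: order_trans[OF _ mult_left_mono])
      thus ?thesis unfolding real_norm_def abs_mult using bound[of u] that st K0 by (intro mult_mono) auto
    qed
    have B2: "norm (f' u * (V u - V t)) \<le> K * (B * (t - s))" if "u \<in> {s..t} - {}" for u
    proof -
      have "\<bar>V u - V t\<bar> \<le> B * (t - s)"
        using VL[of u t] that st B0 by (auto simp: abs_minus_commute intro: order_trans[OF _ mult_left_mono])
      thus ?thesis unfolding real_norm_def abs_mult using K[of u] that st K0 by (intro mult_mono) auto
    qed
    have "norm (X - f s * (V t - V s)) \<le> K * (t - s) * B * measure lborel {s..t}"
      by (rule has_integral_bound_real[OF _ finite.emptyI I1 B1]) (use K0 B0 st in auto)
    moreover have "norm (Y - (f t - f s) * V t) \<le> K * (B * (t - s)) * measure lborel {s..t}"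
      by (rule has_integral_bound_real[OF _ finite.emptyI I2 B2]) (use K0 B0 st in auto)
    moreover have "g t - g s = (X - f s * (V t - V s)) + (Y - (f t - f s) * V t)"
      unfolding eq by (simp add: algebra_simps)
    moreover have "\<bar>p + q\<bar> \<le> P + Q" if "\<bar>p\<bar> \<le> P" "\<bar>q\<bar> \<le> Q" for p q P Q :: real
      using that by linarith
    ultimately have "\<bar>g t - g s\<bar> \<le> K * (t - s) * B * (t - s) + K * (B * (t - s)) * (t - s)"
      using st by (simp only: real_norm_def measure_lborel_Icc)
    thus "\<bar>g t - g s\<bar> \<le> 2 * K * B * (t - s)\<^sup>2" by (simp add: power2_eq_square algebra_simps)
  qed
  hence "integral {a..b} (\<lambda>u. f u * v u) = f b * V b - f a * V a - integral {a..b} (\<lambda>t. f' t * V t)"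
    unfolding g_def by simp
  thus ?thesis using fv by (simp add: has_integral_iff)
qed

section \<open>The candidate trajectory and its costate\<close>

lemma has_derivative_max_shift:
  assumes "x \<noteq> a"
  shows "((\<lambda>x. max 0 (x - a)) has_real_derivative (if x < a then 0 else 1)) (at x)"
proof (cases "x < a")
  case True
  have "((\<lambda>_. 0) has_real_derivative 0) (at x)" by simp
  hence "((\<lambda>x. max 0 (x - a)) has_real_derivative 0) (at x)"
    by (rule has_field_derivative_transform_within_open[of _ _ _ "{..<a}"]) (use True in auto)
  thus ?thesis using True by simp
next
  case False
  have "((\<lambda>x. x - a) has_real_derivative 1) (at x)" by (auto intro!: derivative_eq_intros)
  hence "((\<lambda>x. max 0 (x - a)) has_real_derivative 1) (at x)"
    by (rule has_field_derivative_transform_within_open[of _ _ _ "{a<..}"]) (use assms False in auto)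
  thus ?thesis using False by simp
qed

lemma has_derivative_max_shift_power:
  assumes "x \<noteq> a"
  shows "((\<lambda>x. (max 0 (x - a))^2) has_real_derivative 2 * max 0 (x - a)) (at x)"
    "((\<lambda>x. (max 0 (x - a))^3) has_real_derivative 3 * (max 0 (x - a))^2) (at x)"
  using DERIV_power[OF has_derivative_max_shift[OF assms], of 2]
    DERIV_power[OF has_derivative_max_shift[OF assms], of 3]
  by (auto split: if_splits)

lemma (in scaling) selfsim_has_integral_continuous:
  assumes "continuous_on {0..T} F" "F T = c * F 0" "finite S" "continuous_on {0..T} G"
    and "\<And>x. 0 < x \<Longrightarrow> x < T \<Longrightarrow> x \<notin> S \<Longrightarrow> (F has_real_derivative G x) (at x)"
    and "c = d * \<alpha>" "0 \<le> d" "d \<le> 1" "0 \<le> t"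
  shows "(selfsim \<alpha> T d G has_integral selfsim \<alpha> T c F t - F 0) {0..t}"
proof -
  have "bounded (G ` {0..T})"
    using assms(4) by (intro compact_imp_bounded compact_continuous_image) auto
  then obtain M where M: "\<forall>y\<in>G ` {0..T}. \<bar>y\<bar> \<le> M" unfolding bounded_iff real_norm_def by blast
  show ?thesis
    by (rule selfsim_has_integral[where S = S and M = M]) (use assms M in auto)
qed

text \<open>The approximations are assumed along with the system because two sign facts, the
  direction of the jump in \<open>P3_jump\<close> and the positivity in \<open>Y3_pos\<close>, are
  checked numerically.\<close>

locale chattering =
  fixes \<alpha> T Tinf \<beta>1 \<beta>2 \<beta>3 :: real
  assumes sys: "beta_system \<alpha> T Tinf \<beta>1 \<beta>2 \<beta>3"
    and \<alpha>_approx: "\<bar>\<alpha> - 0.1660687\<bar> \<le> 5 / 10^8"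
    and T_approx: "\<bar>T - 4.2479105\<bar> \<le> 5 / 10^8"
    and \<beta>1_approx: "\<bar>\<beta>1 - 0.4698574\<bar> \<le> 5 / 10^8"
    and \<beta>2_approx: "\<bar>\<beta>2 - 0.8716996\<bar> \<le> 5 / 10^8"
    and \<beta>3_approx: "\<bar>\<beta>3 - 1.0283610\<bar> \<le> 5 / 10^8"

sublocale chattering \<subseteq> scaling
  by unfold_locales (use sys in \<open>auto simp: beta_system_def\<close>)

context chattering
begin

lemma \<beta>_order: "0 < \<beta>1" "\<beta>1 < \<beta>2" "\<beta>2 < 1" "1 < \<beta>3"
  and eq_y1: "(1 - 2 * (1 - \<beta>1) + 2 * (1 - \<beta>2)) * T = 1 - \<alpha>"
  and eq_y2: "(1 - 2 * (1 - \<beta>1)^2 + 2 * (1 - \<beta>2)^2) * T = 2"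
  and eq_y3: "(1 - 2 * (1 - \<beta>1)^3 + 2 * (1 - \<beta>2)^3) * T = 3"
  and eq_p2: "2 * (\<beta>1 + \<beta>2 + \<beta>3) + (\<alpha>^2 - 1) * (\<beta>1 * \<beta>2 + \<beta>1 * \<beta>3 + \<beta>2 * \<beta>3) = 3"
  and eq_p1: "\<beta>1 + \<beta>2 + \<beta>3 - (\<beta>1 * \<beta>2 + \<beta>1 * \<beta>3 + \<beta>2 * \<beta>3) - \<beta>1 * \<beta>2 * \<beta>3 * (\<alpha>^3 - 1) = 1"
  using sys unfolding beta_system_def by blast+

definition W :: "real \<Rightarrow> real" where
  "W x = (if x < \<beta>1*T then -1 else if x < \<beta>2*T then 1 else -1)"
text \<open>Each switch changes the control by 2 or -2 and so adds a truncated power to the state.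
  Powers of \<open>max 0\<close> give one formula for all three arcs and make continuity
  immediate.\<close>

definition Y1 :: "real \<Rightarrow> real" where
  "Y1 x = 1 - x + 2 * max 0 (x - \<beta>1*T) - 2 * max 0 (x - \<beta>2*T)"
definition Y2 :: "real \<Rightarrow> real" where
  "Y2 x = x - x^2/2 + (max 0 (x - \<beta>1*T))^2 - (max 0 (x - \<beta>2*T))^2"
definition Y3 :: "real \<Rightarrow> real" where
  "Y3 x = x^2/2 - x^3/6 + (max 0 (x - \<beta>1*T))^3/3 - (max 0 (x - \<beta>2*T))^3/3"
text \<open>The costate on the first interval for \<open>p0 = 1\<close>.\<close>

definition P1 :: "real \<Rightarrow> real" where
  "P1 x = - (x - \<beta>1*T) * (x - \<beta>2*T) * (x - \<beta>3*T) / 6"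
definition P2 :: "real \<Rightarrow> real" where
  "P2 x = ((x - \<beta>2*T) * (x - \<beta>3*T) + (x - \<beta>1*T) * (x - \<beta>3*T) + (x - \<beta>1*T) * (x - \<beta>2*T)) / 6"
definition P3 :: "real \<Rightarrow> real" where
  "P3 x = (\<beta>1 + \<beta>2 + \<beta>3) * T / 3 - x"

lemma switch_order: "0 < \<beta>1*T" "\<beta>1*T < \<beta>2*T" "\<beta>2*T < T" "T < \<beta>3*T"
  using \<beta>_order T by auto

lemma Y_0 [simp]: "Y1 0 = 1" "Y2 0 = 0" "Y3 0 = 0"
  using switch_order unfolding Y1_def Y2_def Y3_def by auto

lemma max_shift_T: "max 0 (T - \<beta>1*T) = (1 - \<beta>1) * T" "max 0 (T - \<beta>2*T) = (1 - \<beta>2) * T"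
  using switch_order by (auto simp: algebra_simps)

lemma Y1_T: "Y1 T = \<alpha> * Y1 0"
  using eq_y1 unfolding Y_0 unfolding Y1_def max_shift_T by (simp add: algebra_simps)

lemma Y2_T: "Y2 T = \<alpha>^2 * Y2 0"
proof -
  have "Y2 T = T - T / 2 * ((1 - 2 * (1 - \<beta>1)^2 + 2 * (1 - \<beta>2)^2) * T)"
    unfolding Y2_def max_shift_T by (simp add: power2_eq_square field_simps)
  thus ?thesis unfolding eq_y2 by simp
qed

lemma Y3_T: "Y3 T = \<alpha>^3 * Y3 0"
proof -
  have "Y3 T = T^2 / 2 - T^2 / 6 * ((1 - 2 * (1 - \<beta>1)^3 + 2 * (1 - \<beta>2)^3) * T)"
    unfolding Y3_def max_shift_T by (simp add: power2_eq_square power3_eq_cube field_simps)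
  thus ?thesis unfolding eq_y3 by simp
qed

lemma P1_T: "P1 T = \<alpha>^3 * P1 0"
proof -
  have e: "(1 - \<beta>1) * (1 - \<beta>2) * (1 - \<beta>3) = - (\<alpha>^3 * (\<beta>1 * \<beta>2 * \<beta>3))"
    using eq_p1 by (simp add: algebra_simps)
  have P: "P1 T = - (T^3 / 6) * ((1 - \<beta>1) * (1 - \<beta>2) * (1 - \<beta>3))"
    "P1 0 = T^3 / 6 * (\<beta>1 * \<beta>2 * \<beta>3)"
    unfolding P1_def by (simp_all add: power3_eq_cube field_simps)
  show ?thesis unfolding P e by simp
qed

lemma P2_T: "P2 T = \<alpha>^2 * P2 0"
proof -
  have e: "3 - 2 * (\<beta>1 + \<beta>2 + \<beta>3) + (\<beta>1 * \<beta>2 + \<beta>1 * \<beta>3 + \<beta>2 * \<beta>3) = \<alpha>^2 * (\<beta>1 * \<beta>2 + \<beta>1 * \<beta>3 + \<beta>2 * \<beta>3)"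
    using eq_p2 by (simp add: algebra_simps)
  have "P2 T = T^2 / 6 * (3 - 2 * (\<beta>1 + \<beta>2 + \<beta>3) + (\<beta>1 * \<beta>2 + \<beta>1 * \<beta>3 + \<beta>2 * \<beta>3))"
    unfolding P2_def by (simp add: power2_eq_square field_simps)
  also have "\<dots> = \<alpha>^2 * (T^2 / 6 * (\<beta>1 * \<beta>2 + \<beta>1 * \<beta>3 + \<beta>2 * \<beta>3))" unfolding e by simp
  also have "T^2 / 6 * (\<beta>1 * \<beta>2 + \<beta>1 * \<beta>3 + \<beta>2 * \<beta>3) = P2 0"
    unfolding P2_def by (simp add: power2_eq_square field_simps)
  finally show ?thesis .
qed

text \<open>The jump is T (1 - (1 - \<alpha>) (\<beta>1 + \<beta>2 + \<beta>3) / 3), and the sum of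
  the three numbers is about 2.37, hence below 3. It is the source of the inequality in
  \<open>block_duality\<close>.\<close>

lemma P3_jump: "P3 T \<le> \<alpha> * P3 0"
proof -
  have "(1 - \<alpha>) * (\<beta>1 + \<beta>2 + \<beta>3) \<le> 1 * 3"
    using \<alpha> \<alpha>_approx \<beta>1_approx \<beta>2_approx \<beta>3_approx \<beta>_order unfolding abs_le_iff
    by (intro mult_mono) auto
  hence "T * ((1 - \<alpha>) * (\<beta>1 + \<beta>2 + \<beta>3)) \<le> T * 3" using T by (intro mult_left_mono) auto
  thus ?thesis unfolding P3_def by (simp add: algebra_simps)
qed

text \<open>Vanishing of the Hamiltonian at time 0, where the state is e1 and the control is
  -1.\<close>

lemma P1_eq_P2: "P1 0 = P2 0"
proof -
  have "P1 0 = T^2 / 6 * (T * (\<beta>1 * \<beta>2 * \<beta>3))" "P2 0 = T^2 / 6 * (\<beta>1 * \<beta>2 + \<beta>1 * \<beta>3 + \<beta>2 * \<beta>3)"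
    unfolding P1_def P2_def by (simp_all add: power2_eq_square field_simps)
  thus ?thesis unfolding beta_system_hamiltonian[OF sys] by simp
qed

lemma Y_derivs:
  assumes "x \<notin> {\<beta>1*T, \<beta>2*T}"
  shows "(Y1 has_real_derivative W x) (at x)" "(Y2 has_real_derivative Y1 x) (at x)"
    "(Y3 has_real_derivative Y2 x) (at x)"
proof -
  have x: "x \<noteq> \<beta>1*T" "x \<noteq> \<beta>2*T" using assms by auto
  note d = has_derivative_max_shift[OF x(1)] has_derivative_max_shift[OF x(2)]
    has_derivative_max_shift_power[OF x(1)] has_derivative_max_shift_power[OF x(2)]
  show "(Y1 has_real_derivative W x) (at x)" unfolding Y1_def [abs_def] W_def
    by (rule d derivative_eq_intros refl)+ (use x switch_order in auto)
  show "(Y2 has_real_derivative Y1 x) (at x)" unfolding Y2_def [abs_def] Y1_def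
    by (rule d derivative_eq_intros refl)+ (use x switch_order in \<open>auto intro!: d\<close>)
  have "((\<lambda>x. x^2/2 - x^3/6) has_real_derivative x - x^2/2) (at x)"
    by (auto intro!: derivative_eq_intros simp: power2_eq_square)
  from DERIV_diff[OF DERIV_add[OF this DERIV_cdivide[OF d(4), of 3]] DERIV_cdivide[OF d(6), of 3]]
  show "(Y3 has_real_derivative Y2 x) (at x)" unfolding Y3_def [abs_def] Y2_def by simp
qed

lemma P_derivs:
  "(P1 has_real_derivative - P2 x) (at x)" "(P2 has_real_derivative - P3 x) (at x)"
  "(P3 has_real_derivative -1) (at x)"
  unfolding P1_def [abs_def] P2_def [abs_def] P3_def [abs_def]
  by (auto intro!: derivative_eq_intros simp: field_simps)

lemma continuous_Y: "continuous_on S Y1" "continuous_on S Y2" "continuous_on S Y3"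
  unfolding Y1_def [abs_def] Y2_def [abs_def] Y3_def [abs_def] by (intro continuous_intros; simp)+

lemma continuous_P: "continuous_on S P1" "continuous_on S P2" "continuous_on S P3"
  unfolding P1_def [abs_def] P2_def [abs_def] P3_def [abs_def] by (intro continuous_intros; simp)+

text \<open>The first arc is x^2 (3 - x) / 6 with x < 3. Seen from the right end, where the state is
  \<alpha> e1, the last arc is a sum of positive terms. The middle arc is the continuation of the
  last one minus a cube, and only there are the sizes of the switches compared.\<close>

lemma Y3_pos:
  assumes "0 < x" "x < T"
  shows "0 < Y3 x"
proof -
  \<comment> \<open>The polynomial of the last arc, taken for all \<open>z\<close>. Expanding it
    around \<open>T\<close> uses all three junction equations for the state.\<close>
  define Y3_end where "Y3_end z = z^2/2 - z^3/6 + (z - \<beta>1*T)^3/3 - (z - \<beta>2*T)^3/3" for z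
  have Y3_end: "Y3_end z = \<alpha> * (T - z)^2 / 2 + (T - z)^3 / 6" for z
  proof -
    define g where "g = T - z"
    define a where "a = (1 - \<beta>1) * T"
    define b where "b = (1 - \<beta>2) * T"
    define w where "w = T^2"
    have z: "z = T - g" by (simp add: g_def)
    have E1: "T - 2 * a + 2 * b = 1 - \<alpha>" using eq_y1 unfolding a_def b_def by (simp add: algebra_simps)
    have E2: "T^2 - 2 * a^2 + 2 * b^2 = 2 * T"
      using arg_cong[OF eq_y2, of "\<lambda>u. u * T"] unfolding a_def b_def
      by (simp add: power2_eq_square algebra_simps)
    have E3: "T^3 - 2 * a^3 + 2 * b^3 = 3 * T^2"
      using arg_cong[OF eq_y3, of "\<lambda>u. u * T^2"] unfolding a_def b_def
      by (simp add: power2_eq_square power3_eq_cube algebra_simps)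
    have "z - \<beta>1*T = a - g" "z - \<beta>2*T = b - g"
      unfolding a_def b_def g_def by (simp_all add: algebra_simps)
    hence "6 * Y3_end z = 3 * z^2 - z^3 + 2 * (a - g)^3 - 2 * (b - g)^3"
      unfolding Y3_end_def by simp
    also have "\<dots> = 3 * (T - g)^2 - (T - g)^3 + 2 * (a - g)^3 - 2 * (b - g)^3"
      unfolding z ..
    also have "\<dots> = 3 * \<alpha> * g^2 + g^3" using E1 E2 E3 by algebra
    finally show ?thesis unfolding g_def[symmetric] by simp
  qed
  consider "x < \<beta>1*T" | "\<beta>1*T \<le> x" "x < \<beta>2*T" | "\<beta>2*T \<le> x" by linarith
  thus ?thesis
  proof cases
    case 1
    have "\<beta>1 * T < 3"
    proof -
      have "\<beta>1 * T \<le> 0.47 * 4.25"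
        using \<beta>1_approx T_approx \<beta>_order T unfolding abs_le_iff by (intro mult_mono) auto
      thus ?thesis by simp
    qed
    hence "0 < x^2 * (3 - x) / 6" using 1 assms by simp
    also have "\<dots> = Y3 x"
      using 1 switch_order unfolding Y3_def by (simp add: power2_eq_square power3_eq_cube field_simps)
    finally show ?thesis .
  next
    case 2
    define g where "g = T - x"
    define h where "h = \<beta>2*T - x"
    have h: "0 < h" "h < g" using 2 switch_order by (auto simp: h_def g_def)
    have "Y3 x = x^2/2 - x^3/6 + (x - \<beta>1*T)^3/3"
      using 2 unfolding Y3_def by simp
    also have "\<dots> = Y3_end x - h^3 / 3"
      unfolding Y3_end_def h_def by (simp add: field_simps) algebra
    finally have Y3: "Y3 x = \<alpha> * g^2 / 2 + g^3 / 6 - h^3 / 3" unfolding Y3_end g_def .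
    \<comment> \<open>On the middle arc \<open>h\<close> is at most the arc length
      \<open>(\<beta>2 - \<beta>1) * T\<close>, while \<open>g - h\<close> is constantly
      \<open>(1 - \<beta>2) * T\<close>. The resulting factor 13/10 suffices because its cube
      exceeds 2.\<close>
    have "3 * (\<beta>2 - \<beta>1) * T \<le> 10 * (1 - \<beta>2) * T"
      using \<beta>1_approx \<beta>2_approx T unfolding abs_le_iff by (intro mult_right_mono) auto
    hence "3 * h \<le> 10 * (g - h)" using 2 unfolding h_def g_def by (simp add: algebra_simps)
    hence "13/10 * h \<le> g" by simp
    hence "(13/10 * h)^3 \<le> g^3" using h by (intro power_mono) auto
    hence "2197/1000 * h^3 \<le> g^3" by (simp add: power_mult_distrib power_divide)
    moreover have "0 < h^3" "0 < \<alpha> * g^2" using h \<alpha> by auto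
    ultimately show ?thesis unfolding Y3 by linarith
  next
    case 3
    define g where "g = T - x"
    have g: "0 < g" using assms by (simp add: g_def)
    have "Y3 x = Y3_end x" using 3 switch_order unfolding Y3_def Y3_end_def by simp
    also have "\<dots> = \<alpha> * g^2 / 2 + g^3 / 6" unfolding Y3_end g_def ..
    finally have "Y3 x = \<alpha> * g^2 / 2 + g^3 / 6" .
    thus ?thesis using g \<alpha> by (simp add: add_pos_pos)
  qed
qed

end

section \<open>Primitives in the Caratheodory sense\<close>

lemma primitive_continuous:
  fixes f F :: "real \<Rightarrow> real"
  assumes "\<And>t. 0 \<le> t \<Longrightarrow> (f has_integral F t - F 0) {0..t}"
  shows "continuous_on {0..b} F"
proof (cases "0 \<le> b")
  case True
  have "continuous_on {0..b} (\<lambda>t. integral {0..t} f)"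
    by (rule indefinite_integral_continuous_1) (use assms[OF True] in auto)
  hence "continuous_on {0..b} (\<lambda>t. integral {0..t} f + F 0)" by (intro continuous_intros)
  moreover have "integral {0..t} f + F 0 = F t" if "t \<in> {0..b}" for t
    using integral_unique[OF assms[of t]] that by simp
  ultimately show ?thesis by (rule continuous_on_eq)
qed simp

lemma primitive_increment:
  fixes f F :: "real \<Rightarrow> real"
  assumes "\<And>t. 0 \<le> t \<Longrightarrow> (f has_integral F t - F 0) {0..t}" "0 \<le> a" "a \<le> b"
  shows "(f has_integral F b - F a) {a..b}"
proof -
  have int: "f integrable_on {0..b}" using assms by (intro has_integral_integrable[OF assms(1)]) auto
  have "f integrable_on {a..b}"
    by (rule integrable_subinterval_real[OF int]) (use assms in auto)
  moreover have "integral {0..a} f + integral {a..b} f = integral {0..b} f"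
    by (rule Henstock_Kurzweil_Integration.integral_combine) (use assms int in auto)
  moreover have "integral {0..a} f = F a - F 0" "integral {0..b} f = F b - F 0"
    using assms by (auto intro!: integral_unique)
  ultimately show ?thesis by (simp add: has_integral_iff)
qed

context chattering
begin

text \<open>The exponents are the weights of the scaling invariance. The costates carry the
  complementary ones, so that every term of the Hamiltonian scales like
  \<open>\<alpha>^3\<close>.\<close>

definition y1 :: "real \<Rightarrow> real" where "y1 = selfsim \<alpha> T \<alpha> Y1"
definition y2 :: "real \<Rightarrow> real" where "y2 = selfsim \<alpha> T (\<alpha>^2) Y2"
definition y3 :: "real \<Rightarrow> real" where "y3 = selfsim \<alpha> T (\<alpha>^3) Y3"
definition v0 :: "real \<Rightarrow> real" where "v0 = selfsim \<alpha> T 1 W"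
definition q1 :: "real \<Rightarrow> real" where "q1 = selfsim \<alpha> T (\<alpha>^3) P1"
definition q2 :: "real \<Rightarrow> real" where "q2 = selfsim \<alpha> T (\<alpha>^2) P2"
definition q3 :: "real \<Rightarrow> real" where "q3 = selfsim \<alpha> T \<alpha> P3"

lemmas selfsim_defs = y1_def y2_def y3_def v0_def q1_def q2_def q3_def

lemma power_le_1: "\<alpha>^k \<le> 1"
  using \<alpha> by (simp add: power_le_one)

lemma y_integrals:
  assumes "0 \<le> t"
  shows "(v0 has_integral y1 t - y1 0) {0..t}" "(y1 has_integral y2 t - y2 0) {0..t}"
    "(y2 has_integral y3 t - y3 0) {0..t}"
proof -
  note S = selfsim_has_integral[where S = "{\<beta>1*T, \<beta>2*T}"]
    selfsim_has_integral_continuous[where S = "{\<beta>1*T, \<beta>2*T}"]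
  show "(v0 has_integral y1 t - y1 0) {0..t}" unfolding selfsim_defs selfsim_0
    by (rule S(1)[where M = 1]) (use assms Y1_T Y_derivs in \<open>auto intro: continuous_Y simp: W_def\<close>)
  show "(y1 has_integral y2 t - y2 0) {0..t}" unfolding selfsim_defs selfsim_0
    by (rule S(2)) (use assms \<alpha> Y2_T Y_derivs in \<open>auto intro: continuous_Y simp: power2_eq_square\<close>)
  show "(y2 has_integral y3 t - y3 0) {0..t}" unfolding selfsim_defs selfsim_0
    by (rule S(2)) (use assms \<alpha> Y3_T Y_derivs power_le_1[of 2] in \<open>auto intro: continuous_Y simp: power2_eq_square power3_eq_cube\<close>)
qed

lemma selfsim_minus: "selfsim \<alpha> T c (\<lambda>x. - F x) t = - selfsim \<alpha> T c F t"
  by (simp add: selfsim_def)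

lemma q_integrals:
  assumes "0 \<le> t"
  shows "((\<lambda>s. - q2 s) has_integral q1 t - q1 0) {0..t}" "((\<lambda>s. - q3 s) has_integral q2 t - q2 0) {0..t}"
proof -
  note S = selfsim_has_integral_continuous[where S = "{}"]
  have "(selfsim \<alpha> T (\<alpha>^2) (\<lambda>x. - P2 x) has_integral q1 t - q1 0) {0..t}" unfolding selfsim_defs selfsim_0
    by (rule S) (use assms \<alpha> P1_T P_derivs power_le_1[of 2] in \<open>auto intro!: continuous_P continuous_intros simp: power2_eq_square power3_eq_cube\<close>)
  thus "((\<lambda>s. - q2 s) has_integral q1 t - q1 0) {0..t}" by (simp add: selfsim_minus [abs_def] q2_def)
  have "(selfsim \<alpha> T \<alpha> (\<lambda>x. - P3 x) has_integral q2 t - q2 0) {0..t}" unfolding selfsim_defs selfsim_0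
    by (rule S) (use assms \<alpha> P2_T P_derivs in \<open>auto intro!: continuous_P continuous_intros simp: power2_eq_square\<close>)
  thus "((\<lambda>s. - q3 s) has_integral q2 t - q2 0) {0..t}" by (simp add: selfsim_minus [abs_def] q3_def)
qed

lemma y_0 [simp]: "y1 0 = 1" "y2 0 = 0" "y3 0 = 0"
  by (simp_all add: selfsim_defs)

lemma y_tau [simp]: "y1 (\<tau> i) = \<alpha>^i" "y2 (\<tau> i) = 0" "y3 (\<tau> i) = 0"
  by (simp_all add: selfsim_defs)

lemma y_beyond [simp]: "\<tau>inf \<le> t \<Longrightarrow> y1 t = 0" "\<tau>inf \<le> t \<Longrightarrow> y2 t = 0" "\<tau>inf \<le> t \<Longrightarrow> y3 t = 0"
  by (simp_all add: selfsim_defs)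

lemma y3_pos:
  assumes "\<tau> i < t" "t < \<tau> (Suc i)"
  shows "0 < y3 t"
  unfolding y3_def using assms \<alpha> rescaled_bounds_strict[OF assms]
  by (subst selfsim_block[of i]) (auto intro!: mult_pos_pos Y3_pos)

lemma y3_nonneg: "0 \<le> t \<Longrightarrow> 0 \<le> y3 t"
proof (cases "t < \<tau>inf")
  case True
  assume "0 \<le> t"
  then obtain i where "\<tau> i \<le> t" "t < \<tau> (Suc i)" using in_block True by blast
  thus ?thesis using y3_pos[of i t] by (cases "t = \<tau> i") auto
qed simp

lemma y3_eq_0_iff: "0 \<le> t \<Longrightarrow> y3 t = 0 \<longleftrightarrow> t \<in> range \<tau> \<or> \<tau>inf \<le> t"
proof (cases "t < \<tau>inf")
  case True
  assume "0 \<le> t"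
  then obtain i where "\<tau> i \<le> t" "t < \<tau> (Suc i)" using in_block True by blast
  thus ?thesis using y3_pos[of i t] True by (cases "t = \<tau> i") auto
qed simp

lemma v0_bound: "\<bar>v0 t\<bar> \<le> 1"
  unfolding v0_def selfsim_def W_def by auto

lemma v0_measurable: "v0 \<in> borel_measurable (lebesgue_on {0..})"
proof -
  have "(v0 has_integral y1 \<tau>inf - y1 0) {0..\<tau>inf}"
    by (rule y_integrals(1)[OF less_imp_le[OF tau_inf_pos]])
  hence "((\<lambda>t. if t \<in> {0..\<tau>inf} then v0 t else 0) has_integral y1 \<tau>inf - y1 0) {0..}"
    by (subst has_integral_restrict) auto
  hence "(v0 has_integral y1 \<tau>inf - y1 0) {0..}"
    by (rule has_integral_eq[rotated]) (auto simp: v0_def)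
  hence "v0 integrable_on {0..}" by (rule has_integral_integrable)
  thus ?thesis by (rule integrable_imp_measurable)
qed

definition ystar :: "real \<Rightarrow> real^3" where "ystar t = vector [y1 t, y2 t, y3 t]"

lemma ystar_nth [simp]: "ystar t $ 1 = y1 t" "ystar t $ 2 = y2 t" "ystar t $ 3 = y3 t"
  by (simp_all add: ystar_def)

lemma ystar_admissible: "admissible ystar v0"
  unfolding admissible_def
proof (intro conjI allI impI)
  show "ystar 0 = axis 1 1"
    by (simp add: vec_eq_iff forall_3 axis_def)
qed (use v0_measurable y_integrals y3_nonneg v0_bound in auto)

section \<open>Optimality and uniqueness\<close>

lemma q1_continuous: "continuous_on {0..b} q1"
  by (rule primitive_continuous[OF q_integrals(1)])

text \<open>Meant for \<open>u\<close>, \<open>d1\<close>, \<open>d2\<close>, \<open>d3\<close> the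
  differences of the controls and of the states of two processes. Three integrations by parts on one
  block move the costate from \<open>u\<close> to \<open>d3\<close>. The boundary term
  \<open>b i\<close> uses the costate at the start of block i, so that the estimates
  telescope.\<close>

lemma block_duality:
  assumes u: "\<And>t. 0 \<le> t \<Longrightarrow> (u has_integral d1 t - d1 0) {0..t}"
    and d1: "\<And>t. 0 \<le> t \<Longrightarrow> (d1 has_integral d2 t - d2 0) {0..t}"
    and d2: "\<And>t. 0 \<le> t \<Longrightarrow> (d2 has_integral d3 t - d3 0) {0..t}"
    and bound: "\<And>t. 0 \<le> t \<Longrightarrow> \<bar>u t\<bar> \<le> B" and nn: "0 \<le> d3 (\<tau> (Suc i))"
  defines "b \<equiv> \<lambda>i. (\<alpha>^3)^i * P1 0 * d1 (\<tau> i) + (\<alpha>^2)^i * P2 0 * d2 (\<tau> i) + \<alpha>^i * P3 0 * d3 (\<tau> i)"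
  shows "integral {\<tau> i..\<tau> (Suc i)} (\<lambda>t. q1 t * u t) \<le> b (Suc i) - b i + integral {\<tau> i..\<tau> (Suc i)} d3"
proof -
  let ?a = "\<tau> i" and ?b = "\<tau> (Suc i)"
  have ab: "?a \<le> ?b" by simp
  define x where "x t = (t - ?a) / \<alpha>^i" for t
  define f1 where "f1 t = (\<alpha>^3)^i * P1 (x t)" for t
  define f2 where "f2 t = (\<alpha>^2)^i * P2 (x t)" for t
  define f3 where "f3 t = \<alpha>^i * P3 (x t)" for t
  have x: "x ?a = 0" "x ?b = T" using \<alpha> by (simp_all add: x_def tau_Suc)
  have dx: "(x has_real_derivative 1 / \<alpha>^i) (at t within S)" for t S
    unfolding x_def [abs_def] using \<alpha> by (auto intro!: derivative_eq_intros)
  have pw: "(\<alpha>^3)^i = (\<alpha>^2)^i * \<alpha>^i" "(\<alpha>^2)^i = \<alpha>^i * \<alpha>^i"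
    by (simp_all add: power_mult_distrib power3_eq_cube power2_eq_square)
  have f1': "(f1 has_real_derivative - f2 t) (at t within S)" for t S
    using DERIV_cmult[OF DERIV_chain2[OF P_derivs(1) dx], of "(\<alpha>^3)^i"] \<alpha>
    unfolding f1_def [abs_def] f2_def pw(1) by simp
  have f2': "(f2 has_real_derivative - f3 t) (at t within S)" for t S
    using DERIV_cmult[OF DERIV_chain2[OF P_derivs(2) dx], of "(\<alpha>^2)^i"] \<alpha>
    unfolding f2_def [abs_def] f3_def pw(2) by simp
  have f3': "(f3 has_real_derivative - 1) (at t within S)" for t S
    using DERIV_cmult[OF DERIV_chain2[OF P_derivs(3) dx], of "\<alpha>^i"] \<alpha>
    unfolding f3_def [abs_def] by simp
  have cont_f: "continuous_on S f2" "continuous_on S f3" for S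
    by (rule DERIV_continuous_on[OF f2'], rule DERIV_continuous_on[OF f3'])
  have cont_d: "continuous_on {?a..?b} d1" "continuous_on {?a..?b} d2"
    using primitive_continuous[OF u, of ?b] primitive_continuous[OF d1, of ?b]
    by (auto elim!: continuous_on_subset intro: order_trans[OF tau_nonneg])
  obtain B1 where B1: "\<And>t. t \<in> {?a..?b} \<Longrightarrow> \<bar>d1 t\<bar> \<le> B1"
    using compact_imp_bounded[OF compact_continuous_image[OF cont_d(1) compact_Icc]]
    unfolding bounded_iff real_norm_def by fast
  obtain B2 where B2: "\<And>t. t \<in> {?a..?b} \<Longrightarrow> \<bar>d2 t\<bar> \<le> B2"
    using compact_imp_bounded[OF compact_continuous_image[OF cont_d(2) compact_Icc]]
    unfolding bounded_iff real_norm_def by fast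
  have inc: "(g has_integral G t - G ?a) {?a..t}"
    if "\<And>t. 0 \<le> t \<Longrightarrow> (g has_integral G t - G 0) {0..t}" "t \<in> {?a..?b}" for g G :: "real \<Rightarrow> real" and t
    by (rule primitive_increment[OF that(1)]) (use that in auto)
  have I1: "integral {?a..?b} (\<lambda>t. f1 t * u t) = f1 ?b * d1 ?b - f1 ?a * d1 ?a + integral {?a..?b} (\<lambda>t. f2 t * d1 t)"
    using integration_by_parts_bounded[OF ab f1' _ inc[OF u], of B] bound cont_f
    by (auto dest!: integral_unique intro: continuous_intros order_trans[OF tau_nonneg])
  have I2: "integral {?a..?b} (\<lambda>t. f2 t * d1 t) = f2 ?b * d2 ?b - f2 ?a * d2 ?a + integral {?a..?b} (\<lambda>t. f3 t * d2 t)"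
    using integration_by_parts_bounded[OF ab f2' _ inc[OF d1], of B1] B1 cont_f
    by (auto dest!: integral_unique intro: continuous_intros)
  have I3: "integral {?a..?b} (\<lambda>t. f3 t * d2 t) = f3 ?b * d3 ?b - f3 ?a * d3 ?a + integral {?a..?b} d3"
    using integration_by_parts_bounded[OF ab f3' _ inc[OF d2], of B2] B2
    by (auto dest!: integral_unique intro: continuous_intros)
  have q1: "q1 t = f1 t" if "t \<in> {?a..?b}" for t
    unfolding q1_def f1_def x_def using that P1_T by (intro selfsim_closed_block) auto
  have b_i: "b i = f1 ?a * d1 ?a + f2 ?a * d2 ?a + f3 ?a * d3 ?a"
    unfolding b_def f1_def f2_def f3_def x ..
  have "integral {?a..?b} (\<lambda>t. q1 t * u t) = integral {?a..?b} (\<lambda>t. f1 t * u t)"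
    using q1 by (intro integral_cong) auto
  also have "\<dots> = f1 ?b * d1 ?b + f2 ?b * d2 ?b + f3 ?b * d3 ?b - b i + integral {?a..?b} d3"
    unfolding I1 I2 I3 b_i by simp
  \<comment> \<open>The first two components agree with the start of the next block. The third falls
    short by its jump, which is multiplied by \<open>d3 \<ge> 0\<close>.\<close>
  also have "f1 ?b * d1 ?b + f2 ?b * d2 ?b + f3 ?b * d3 ?b \<le> b (Suc i)"
  proof -
    have "\<alpha>^i * P3 T \<le> \<alpha>^i * (\<alpha> * P3 0)" using P3_jump \<alpha> by (intro mult_left_mono) auto
    hence "\<alpha>^i * P3 T * d3 ?b \<le> \<alpha>^i * (\<alpha> * P3 0) * d3 ?b" using nn by (rule mult_right_mono)
    thus ?thesis unfolding f1_def f2_def f3_def x b_def P1_T P2_T by (simp add: ac_simps)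
  qed
  finally show ?thesis by simp
qed

text \<open>Summation of \<open>block_duality\<close>. The initial boundary term is 0 because both
  processes start at the same state; the final one tends to 0 because geometric factors multiply
  convergent values of \<open>d1\<close>, \<open>d2\<close>, \<open>d3\<close>.\<close>

lemma duality:
  assumes u: "\<And>t. 0 \<le> t \<Longrightarrow> (u has_integral d1 t - d1 0) {0..t}"
    and d1: "\<And>t. 0 \<le> t \<Longrightarrow> (d1 has_integral d2 t - d2 0) {0..t}"
    and d2: "\<And>t. 0 \<le> t \<Longrightarrow> (d2 has_integral d3 t - d3 0) {0..t}"
    and init: "d1 0 = 0" "d2 0 = 0" "d3 0 = 0"
    and bound: "\<And>t. 0 \<le> t \<Longrightarrow> \<bar>u t\<bar> \<le> B" and nn: "\<And>i. 0 \<le> d3 (\<tau> i)"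
  shows "integral {0..\<tau>inf} (\<lambda>t. q1 t * u t) \<le> integral {0..\<tau>inf} d3"
proof -
  define b where "b i = (\<alpha>^3)^i * P1 0 * d1 (\<tau> i) + (\<alpha>^2)^i * P2 0 * d2 (\<tau> i) + \<alpha>^i * P3 0 * d3 (\<tau> i)" for i
  have qu: "(\<lambda>t. q1 t * u t) integrable_on {0..c}" if "0 \<le> c" for c
    using product_integrable[OF q1_continuous has_integral_integrable[OF u[OF that]]] bound
    by (auto intro: set_lebesgue_integral_eq_integral(1))
  have cont: "continuous_on {0..\<tau>inf} d1" "continuous_on {0..\<tau>inf} d2" "continuous_on {0..c} d3" for c
    using primitive_continuous[OF u] primitive_continuous[OF d1] primitive_continuous[OF d2] by auto
  have d3i: "d3 integrable_on {0..c}" for c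
    using cont(3) by (rule integrable_continuous_real)
  have step: "integral {0..\<tau> N} (\<lambda>t. q1 t * u t) \<le> b N + integral {0..\<tau> N} d3" for N
  proof (induction N)
    case 0
    show ?case using init by (simp add: b_def)
  next
    case (Suc N)
    have "integral {0..\<tau> N} (\<lambda>t. q1 t * u t) + integral {\<tau> N..\<tau> (Suc N)} (\<lambda>t. q1 t * u t) = integral {0..\<tau> (Suc N)} (\<lambda>t. q1 t * u t)"
      "integral {0..\<tau> N} d3 + integral {\<tau> N..\<tau> (Suc N)} d3 = integral {0..\<tau> (Suc N)} d3"
      by (rule Henstock_Kurzweil_Integration.integral_combine; simp add: qu d3i)+
    with Suc block_duality[OF u d1 d2 bound nn, where i = N, folded b_def] show ?case by simp
  qed
  have lim: "(\<lambda>N. integral {0..\<tau> N} f) \<longlonglongrightarrow> integral {0..\<tau>inf} f"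
    if "f integrable_on {0..\<tau>inf}" for f :: "real \<Rightarrow> real"
  proof -
    have "((\<lambda>t. integral {0..t} f) \<longlongrightarrow> integral {0..\<tau>inf} f) (at \<tau>inf within {0..\<tau>inf})"
      using indefinite_integral_continuous_1[OF that] tau_inf_pos by (auto simp: continuous_on_def)
    moreover have "filterlim \<tau> (at \<tau>inf within {0..\<tau>inf}) sequentially"
      unfolding filterlim_at using tau_tendsto tau_less_inf
      by (auto intro!: always_eventually less_imp_le less_imp_neq)
    ultimately show ?thesis by (rule filterlim_compose)
  qed
  have nul: "(\<lambda>N. c^N * k * d (\<tau> N)) \<longlonglongrightarrow> 0"
    if c: "0 \<le> c" "c < 1" and d: "continuous_on {0..\<tau>inf} d" for c k and d :: "real \<Rightarrow> real"
  proof -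
    have "(d \<longlongrightarrow> d \<tau>inf) (at \<tau>inf within {0..\<tau>inf})"
      using d tau_inf_pos by (auto simp: continuous_on_def)
    moreover have "filterlim \<tau> (at \<tau>inf within {0..\<tau>inf}) sequentially"
      unfolding filterlim_at using tau_tendsto tau_less_inf
      by (auto intro!: always_eventually less_imp_le less_imp_neq)
    ultimately have "(\<lambda>N. d (\<tau> N)) \<longlonglongrightarrow> d \<tau>inf" by (rule filterlim_compose)
    hence "(\<lambda>N. c^N * k * d (\<tau> N)) \<longlonglongrightarrow> 0 * k * d \<tau>inf"
      using c by (intro tendsto_intros LIMSEQ_realpow_zero) auto
    thus ?thesis by simp
  qed
  have "b \<longlonglongrightarrow> 0 + 0 + 0" unfolding b_def [abs_def]
    by (intro tendsto_add nul cont) (use \<alpha> in \<open>auto simp: power_less_one_iff\<close>)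
  hence "(\<lambda>N. b N + integral {0..\<tau> N} d3) \<longlonglongrightarrow> 0 + integral {0..\<tau>inf} d3"
    by (intro tendsto_add lim d3i) simp
  hence "integral {0..\<tau>inf} (\<lambda>t. q1 t * u t) \<le> 0 + integral {0..\<tau>inf} d3"
    using tendsto_le[OF _ _ lim[OF qu]] step tau_inf_pos by (auto intro: LIMSEQ_le)
  thus ?thesis by simp
qed

text \<open>Since \<open>\<beta>3 > 1\<close>, the third zero of \<open>P1\<close> lies beyond
  \<open>T\<close>. On the interval the sign therefore changes exactly at the two switches and is
  opposite to \<open>W\<close>, which makes \<open>W\<close> the minimizer of
  \<open>P1 x * w\<close>.\<close>

lemma P1_sign:
  assumes "0 \<le> x" "x \<le> T" "\<bar>w\<bar> \<le> 1"
  shows "0 \<le> P1 x * (w - W x)"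
    and "x \<noteq> \<beta>1*T \<Longrightarrow> x \<noteq> \<beta>2*T \<Longrightarrow> P1 x * (w - W x) = 0 \<Longrightarrow> w = W x"
proof -
  note so = switch_order
  define a b c where "a = x - \<beta>1*T" and "b = x - \<beta>2*T" and "c = \<beta>3*T - x"
  have P1: "P1 x = a * b * c / 6" unfolding P1_def a_def b_def c_def by algebra
  have c: "c > 0" using so(4) assms(2) unfolding c_def by linarith
  have abc: "a < 0 \<and> b < 0 \<and> W x = -1 \<or> a \<ge> 0 \<and> b < 0 \<and> W x = 1 \<or> a > 0 \<and> b \<ge> 0 \<and> W x = -1"
    using so unfolding a_def b_def W_def by auto
  have w: "0 \<le> w + 1" "w - 1 \<le> 0" using assms(3) by auto
  have "0 \<le> a * b * (w - W x)"
    using abc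
  proof (elim disjE conjE)
    assume "a < 0" "b < 0" "W x = -1"
    thus ?thesis using w by (simp add: mult_neg_neg mult_nonneg_nonneg less_imp_le)
  next
    assume "a \<ge> 0" "b < 0" "W x = 1"
    thus ?thesis using w by (simp add: mult_nonneg_nonpos mult_nonpos_nonpos less_imp_le)
  next
    assume "a > 0" "b \<ge> 0" "W x = -1"
    thus ?thesis using w by (simp add: mult_nonneg_nonneg less_imp_le)
  qed
  hence "0 \<le> c / 6 * (a * b * (w - W x))" using c by simp
  thus "0 \<le> P1 x * (w - W x)" unfolding P1 by (simp add: ac_simps)
  show "w = W x" if "x \<noteq> \<beta>1*T" "x \<noteq> \<beta>2*T" "P1 x * (w - W x) = 0"
    using that c unfolding P1 a_def b_def by auto
qed

lemma q1_sign:
  assumes "0 \<le> t" "\<bar>w\<bar> \<le> 1"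
  shows "0 \<le> q1 t * (w - v0 t)"
    and "t < \<tau>inf \<Longrightarrow> (\<And>i. t \<noteq> \<tau> i + \<alpha>^i * (\<beta>1*T) \<and> t \<noteq> \<tau> i + \<alpha>^i * (\<beta>2*T)) \<Longrightarrow>
      q1 t * (w - v0 t) = 0 \<Longrightarrow> w = v0 t"
proof -
  show "0 \<le> q1 t * (w - v0 t)"
  proof (cases "t < \<tau>inf")
    case True
    then obtain i where i: "\<tau> i \<le> t" "t < \<tau> (Suc i)" using in_block assms by blast
    have "q1 t * (w - v0 t) = (\<alpha>^3)^i * (P1 ((t - \<tau> i) / \<alpha>^i) * (w - W ((t - \<tau> i) / \<alpha>^i)))"
      unfolding q1_def v0_def selfsim_block[OF i] by simp
    moreover have "0 \<le> P1 ((t - \<tau> i) / \<alpha>^i) * (w - W ((t - \<tau> i) / \<alpha>^i))"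
      using rescaled_bounds[of i t] i assms by (intro P1_sign) auto
    ultimately show ?thesis using \<alpha> by simp
  qed (simp add: q1_def)
  assume t: "t < \<tau>inf" and sw: "\<And>i. t \<noteq> \<tau> i + \<alpha>^i * (\<beta>1*T) \<and> t \<noteq> \<tau> i + \<alpha>^i * (\<beta>2*T)"
    and eq: "q1 t * (w - v0 t) = 0"
  obtain i where i: "\<tau> i \<le> t" "t < \<tau> (Suc i)" using in_block assms t by blast
  define x where "x = (t - \<tau> i) / \<alpha>^i"
  have tx: "t = \<tau> i + \<alpha>^i * x" using \<alpha> by (simp add: x_def)
  have "x \<noteq> \<beta>1*T" "x \<noteq> \<beta>2*T" using sw[of i] unfolding tx by auto
  moreover have "P1 x * (w - W x) = 0"
    using eq \<alpha> unfolding q1_def v0_def selfsim_block[OF i] x_def by simp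
  ultimately have "w = W x"
    using rescaled_bounds[of i t] i assms unfolding x_def by (intro P1_sign) auto
  thus "w = v0 t" unfolding v0_def selfsim_block[OF i] x_def by simp
qed

end

section \<open>Admissible trajectories and their cost\<close>

lemma admissible_integrals:
  assumes "admissible y v" "0 \<le> t"
  shows "(v has_integral y t $ 1 - y 0 $ 1) {0..t}" "((\<lambda>s. y s $ 1) has_integral y t $ 2 - y 0 $ 2) {0..t}"
    "((\<lambda>s. y s $ 2) has_integral y t $ 3 - y 0 $ 3) {0..t}"
  using assms unfolding admissible_def by blast+

lemma admissible_initial:
  assumes "admissible y v"
  shows "y 0 $ 1 = 1" "y 0 $ 2 = 0" "y 0 $ 3 = 0"
  using assms by (simp_all add: admissible_def axis_def)

lemma admissible_nonneg: "admissible y v \<Longrightarrow> 0 \<le> t \<Longrightarrow> 0 \<le> y t $ 3"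
  using admissible_initial(3)[of y v] unfolding admissible_def by (cases "t = 0") auto

lemma admissible_continuous:
  assumes "admissible y v"
  shows "continuous_on {0..b} (\<lambda>t. y t $ 1)" "continuous_on {0..b} (\<lambda>t. y t $ 2)" "continuous_on {0..b} (\<lambda>t. y t $ 3)"
  using admissible_integrals[OF assms] by (auto intro: primitive_continuous)

lemma cost_ge:
  assumes "admissible y v" "0 \<le> R"
  shows "ennreal (integral {0..R} (\<lambda>t. y t $ 3)) \<le> cost y"
proof -
  have "((\<lambda>t. y t $ 3) has_integral integral {0..R} (\<lambda>t. y t $ 3)) {0..R}"
    by (intro integrable_integral integrable_continuous_real admissible_continuous[OF assms(1)])
  hence "ennreal (integral {0..R} (\<lambda>t. y t $ 3)) = (\<integral>\<^sup>+t\<in>{0..R}. ennreal (y t $ 3) \<partial>lborel)"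
    using admissible_nonneg[OF assms(1)] by (intro nn_integral_has_integral_lebesgue'[symmetric]) auto
  also have "\<dots> \<le> cost y"
    unfolding cost_def by (intro nn_integral_mono) (auto simp: indicator_def)
  finally show ?thesis .
qed

lemma AE_zero_of_nonneg_integral_zero:
  fixes f :: "real \<Rightarrow> real"
  assumes "f absolutely_integrable_on S" "\<And>x. x \<in> S \<Longrightarrow> 0 \<le> f x" "integral S f = 0"
  shows "AE x in lebesgue. x \<in> S \<longrightarrow> f x = 0"
proof -
  have "(LINT x:S|lebesgue. f x) = 0"
    using set_lebesgue_integral_eq_integral(2)[OF assms(1)] assms(3) by simp
  hence "AE x in lebesgue. indicator S x *\<^sub>R f x = 0"
    using integral_nonneg_eq_0_iff_AE[of lebesgue "\<lambda>x. indicator S x *\<^sub>R f x"] assms(1,2)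
    unfolding set_integrable_def set_lebesgue_integral_def by (simp add: indicator_def)
  thus ?thesis by eventually_elim (simp add: indicator_def split: if_splits)
qed

context chattering
begin

text \<open>Duality between an arbitrary admissible process and the candidate. The difference
  \<open>u\<close> is set to 0 at time 0 because admissibility bounds \<open>v\<close> only at
  positive times.\<close>

lemma admissible_gap:
  assumes adm: "admissible y v"
  defines "u \<equiv> \<lambda>t. if t \<le> 0 then 0 else v t - v0 t"
  shows "integral {0..\<tau>inf} (\<lambda>t. q1 t * u t) \<le> integral {0..\<tau>inf} (\<lambda>t. y t $ 3) - integral {0..\<tau>inf} y3"
    "(\<lambda>t. q1 t * u t) absolutely_integrable_on {0..\<tau>inf}"
    "\<And>t. 0 \<le> t \<Longrightarrow> 0 \<le> q1 t * u t"
    "\<And>t. 0 \<le> t \<Longrightarrow> (u has_integral y t $ 1 - y1 t) {0..t}"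
    "\<And>t. 0 \<le> t \<Longrightarrow> ((\<lambda>s. y s $ 1 - y1 s) has_integral y t $ 2 - y2 t) {0..t}"
    "\<And>t. 0 \<le> t \<Longrightarrow> ((\<lambda>s. y s $ 2 - y2 s) has_integral y t $ 3 - y3 t) {0..t}"
proof -
  note ini = admissible_initial[OF adm]
  have v: "\<bar>v t\<bar> \<le> 1" if "0 < t" for t using adm that by (auto simp: admissible_def)
  have bound: "\<bar>u t\<bar> \<le> 2" for t using v[of t] v0_bound[of t] by (auto simp: u_def)
  have u: "(u has_integral (y t $ 1 - y1 t)) {0..t}" if t: "0 \<le> t" for t
  proof -
    have "((\<lambda>s. v s - v0 s) has_integral (y t $ 1 - y 0 $ 1) - (y1 t - y1 0)) {0..t}"
      by (intro has_integral_diff admissible_integrals[OF adm] y_integrals t)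
    hence "(u has_integral (y t $ 1 - y 0 $ 1) - (y1 t - y1 0)) {0..t}"
      by (rule has_integral_spike_finite[of "{0}", rotated 2]) (auto simp: u_def)
    thus ?thesis using ini by simp
  qed
  have d1: "((\<lambda>s. y s $ 1 - y1 s) has_integral y t $ 2 - y2 t) {0..t}"
    and d2: "((\<lambda>s. y s $ 2 - y2 s) has_integral y t $ 3 - y3 t) {0..t}" if t: "0 \<le> t" for t
    using has_integral_diff[OF admissible_integrals(2)[OF adm t] y_integrals(2)[OF t]]
      has_integral_diff[OF admissible_integrals(3)[OF adm t] y_integrals(3)[OF t]] ini by auto
  have "integral {0..\<tau>inf} (\<lambda>t. q1 t * u t) \<le> integral {0..\<tau>inf} (\<lambda>t. y t $ 3 - y3 t)"
    by (rule duality[where ?d1.0 = "\<lambda>t. y t $ 1 - y1 t" and ?d2.0 = "\<lambda>t. y t $ 2 - y2 t" and B = 2])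
      (use u d1 d2 ini bound admissible_nonneg[OF adm] in auto)
  also have "\<dots> = integral {0..\<tau>inf} (\<lambda>t. y t $ 3) - integral {0..\<tau>inf} y3"
    by (intro Henstock_Kurzweil_Integration.integral_diff integrable_continuous_real
        admissible_continuous[OF adm] primitive_continuous[OF y_integrals(3)])
  finally show "integral {0..\<tau>inf} (\<lambda>t. q1 t * u t) \<le> integral {0..\<tau>inf} (\<lambda>t. y t $ 3) - integral {0..\<tau>inf} y3" .
  show "(\<lambda>t. q1 t * u t) absolutely_integrable_on {0..\<tau>inf}"
    by (rule product_integrable[OF q1_continuous has_integral_integrable[OF u] bound]) (use tau_inf_pos in simp)
  show "0 \<le> q1 t * u t" if "0 \<le> t" for t
    using q1_sign(1)[OF that v] that by (auto simp: u_def)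
  show "\<And>t. 0 \<le> t \<Longrightarrow> (u has_integral y t $ 1 - y1 t) {0..t}"
    "\<And>t. 0 \<le> t \<Longrightarrow> ((\<lambda>s. y s $ 1 - y1 s) has_integral y t $ 2 - y2 t) {0..t}"
    "\<And>t. 0 \<le> t \<Longrightarrow> ((\<lambda>s. y s $ 2 - y2 s) has_integral y t $ 3 - y3 t) {0..t}"
    by (fact u d1 d2)+
qed

lemma cost_ystar: "cost ystar = ennreal (integral {0..\<tau>inf} y3)"
proof -
  have "(y3 has_integral integral {0..\<tau>inf} y3) {0..\<tau>inf}"
    by (intro integrable_integral integrable_continuous_real primitive_continuous[OF y_integrals(3)])
  hence "((\<lambda>t. if t \<in> {0..\<tau>inf} then y3 t else 0) has_integral integral {0..\<tau>inf} y3) {0..}"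
    by (subst has_integral_restrict) auto
  hence "(y3 has_integral integral {0..\<tau>inf} y3) {0..}"
    by (rule has_integral_eq[rotated]) auto
  hence "(\<integral>\<^sup>+t\<in>{0..}. ennreal (y3 t) \<partial>lborel) = ennreal (integral {0..\<tau>inf} y3)"
    using y3_nonneg by (intro nn_integral_has_integral_lebesgue') auto
  thus ?thesis by (simp add: cost_def)
qed

text \<open>It is enough to compare on \<open>{0..\<tau>inf}\<close>: the candidate pays nothing
  later, and a competitor cannot gain there since its third component is nonnegative.\<close>

lemma ystar_optimal: "optimal ystar v0"
  unfolding optimal_def
proof (intro conjI allI impI ystar_admissible)
  fix y v assume adm: "admissible y v"
  note gap = admissible_gap[OF adm]
  have "0 \<le> integral {0..\<tau>inf} (\<lambda>t. q1 t * (if t \<le> 0 then 0 else v t - v0 t))"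
    by (intro integral_nonneg set_lebesgue_integral_eq_integral(1)[OF gap(2)] gap(3)) simp
  with gap(1) have "integral {0..\<tau>inf} y3 \<le> integral {0..\<tau>inf} (\<lambda>t. y t $ 3)" by linarith
  hence "cost ystar \<le> ennreal (integral {0..\<tau>inf} (\<lambda>t. y t $ 3))"
    unfolding cost_ystar by (rule ennreal_leI)
  also have "\<dots> \<le> cost y" using tau_inf_pos by (intro cost_ge[OF adm]) simp
  finally show "cost ystar \<le> cost y" .
qed

lemma optimal_unique:
  assumes opt: "optimal y v"
  shows "AE t in lebesgue. 0 < t \<and> t < \<tau>inf \<longrightarrow> v t = v0 t"
    "\<And>t. 0 \<le> t \<Longrightarrow> t \<le> \<tau>inf \<Longrightarrow> y t = ystar t"
    "\<And>t. 0 \<le> t \<Longrightarrow> y t $ 3 = y3 t"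
proof -
  have adm: "admissible y v" using opt by (simp add: optimal_def)
  define u where "u t = (if t \<le> 0 then 0 else v t - v0 t)" for t
  note gap = admissible_gap[OF adm, folded u_def]
  \<comment> \<open>Needed for all \<open>R\<close>: the value \<open>\<tau>inf\<close> gives
    equality in the duality estimate, and larger values leave no cost for the tail, where the
    nonnegative continuous third component must then vanish.\<close>
  have le: "integral {0..R} (\<lambda>t. y t $ 3) \<le> integral {0..\<tau>inf} y3" if "0 \<le> R" for R
  proof -
    have "ennreal (integral {0..R} (\<lambda>t. y t $ 3)) \<le> cost y" using that by (rule cost_ge[OF adm])
    also have "\<dots> \<le> cost ystar" using opt ystar_optimal unfolding optimal_def by blast
    finally show ?thesis unfolding cost_ystar
      by (subst (asm) ennreal_le_iff) (auto intro!: integral_nonneg y3_nonneg integrable_continuous_real primitive_continuous[OF y_integrals(3)])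
  qed
  have qu: "(\<lambda>t. q1 t * u t) integrable_on {0..\<tau>inf}"
    by (rule set_lebesgue_integral_eq_integral(1)[OF gap(2)])
  have "0 \<le> integral {0..\<tau>inf} (\<lambda>t. q1 t * u t)"
    by (intro integral_nonneg qu gap(3)) simp
  with gap(1) le[of \<tau>inf] tau_inf_pos have zero: "integral {0..\<tau>inf} (\<lambda>t. q1 t * u t) = 0"
    and ge: "integral {0..\<tau>inf} y3 \<le> integral {0..\<tau>inf} (\<lambda>t. y t $ 3)" by auto
  have ae: "AE t in lebesgue. t \<in> {0..\<tau>inf} \<longrightarrow> q1 t * u t = 0"
    by (rule AE_zero_of_nonneg_integral_zero[OF gap(2) _ zero]) (use gap(3) in auto)
  \<comment> \<open>All switching times, the only zeros of \<open>q1\<close> before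
    \<open>\<tau>inf\<close>; being countable, they form a null set.\<close>
  define Sw where "Sw = range (\<lambda>i. \<tau> i + \<alpha>^i * (\<beta>1*T)) \<union> range (\<lambda>i. \<tau> i + \<alpha>^i * (\<beta>2*T))"
  have "countable Sw" unfolding Sw_def by auto
  hence "AE t in lebesgue. t \<notin> Sw" by (intro AE_completion AE_not_in countable_imp_null_set_lborel)
  with ae show aev: "AE t in lebesgue. 0 < t \<and> t < \<tau>inf \<longrightarrow> v t = v0 t"
  proof eventually_elim
    case (elim t)
    show ?case
    proof
      assume t: "0 < t \<and> t < \<tau>inf"
      hence "\<bar>v t\<bar> \<le> 1" using adm by (simp add: admissible_def)
      thus "v t = v0 t"
        using q1_sign(2)[of t "v t"] elim t unfolding u_def Sw_def by auto
    qed
  qed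
  have u0: "y t $ 1 = y1 t" if t: "0 \<le> t" "t \<le> \<tau>inf" for t
  proof -
    have "AE s in lebesgue. s \<noteq> \<tau>inf"
      by (rule AE_completion[OF AE_lborel_singleton])
    with aev have "AE s in lebesgue. s \<in> {0..t} \<longrightarrow> u s = 0"
      by eventually_elim (use t in \<open>auto simp: u_def\<close>)
    hence "AE s in lborel. s \<in> {0..t} \<longrightarrow> u s = 0" by (simp add: AE_completion_iff)
    from has_integral_AE[OF this] gap(4)[OF t(1)] have "((\<lambda>s. 0) has_integral y t $ 1 - y1 t) {0..t}" by simp
    from has_integral_unique[OF this has_integral_0] show ?thesis by simp
  qed
  have u1: "y t $ 2 = y2 t" if t: "0 \<le> t" "t \<le> \<tau>inf" for t
  proof -
    have "((\<lambda>s. 0) has_integral y t $ 2 - y2 t) {0..t}"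
      by (rule has_integral_eq[OF _ gap(5)[OF t(1)]]) (use u0 t in auto)
    from has_integral_unique[OF this has_integral_0] show ?thesis by simp
  qed
  have u2: "y t $ 3 = y3 t" if t: "0 \<le> t" "t \<le> \<tau>inf" for t
  proof -
    have "((\<lambda>s. 0) has_integral y t $ 3 - y3 t) {0..t}"
      by (rule has_integral_eq[OF _ gap(6)[OF t(1)]]) (use u1 t in auto)
    from has_integral_unique[OF this has_integral_0] show ?thesis by simp
  qed
  show "y t = ystar t" if "0 \<le> t" "t \<le> \<tau>inf" for t
    using u0 u1 u2 that by (simp add: vec_eq_iff forall_3)
  show "y t $ 3 = y3 t" if t: "0 \<le> t" for t
  proof (cases "t \<le> \<tau>inf")
    case False
    have cont: "continuous_on {0..t} (\<lambda>t. y t $ 3)" by (rule admissible_continuous[OF adm])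
    hence cont': "continuous_on {\<tau>inf..t} (\<lambda>t. y t $ 3)"
      by (rule continuous_on_subset) (use tau_inf_pos in auto)
    have nn: "0 \<le> y s $ 3" if "s \<in> {\<tau>inf..t}" for s
      using admissible_nonneg[OF adm, of s] that tau_inf_pos by auto
    have "integral {0..\<tau>inf} (\<lambda>t. y t $ 3) + integral {\<tau>inf..t} (\<lambda>t. y t $ 3) = integral {0..t} (\<lambda>t. y t $ 3)"
      using False tau_inf_pos cont
      by (intro Henstock_Kurzweil_Integration.integral_combine integrable_continuous_real) auto
    with le[OF t] ge have "integral {\<tau>inf..t} (\<lambda>t. y t $ 3) \<le> 0" by linarith
    moreover have "0 \<le> integral {\<tau>inf..t} (\<lambda>t. y t $ 3)"
      by (intro integral_nonneg integrable_continuous_real cont' nn)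
    ultimately have "\<forall>s\<in>{\<tau>inf..t}. y s $ 3 = 0"
      using integral_eq_0_iff[OF cont' _ nn] False by auto
    thus ?thesis using False by simp
  qed (use u2 t in auto)
qed

section \<open>Junction times, control and costates\<close>

text \<open>The delicate point is \<open>\<tau>inf\<close>: it is no junction, because zeros
  accumulate on its left and the constraint stays active on its right.\<close>

lemma junction_time_iff:
  assumes y: "\<And>t. 0 \<le> t \<Longrightarrow> y t $ 3 = y3 t"
  shows "junction_time y t \<longleftrightarrow> t \<in> range \<tau>"
proof
  assume "t \<in> range \<tau>"
  then obtain i where t: "t = \<tau> i" by blast
  have "\<forall>s\<in>{\<tau> i<..<\<tau> i + \<alpha>^i * T}. 0 < y s $ 3"
  proof
    fix s assume "s \<in> {\<tau> i<..<\<tau> i + \<alpha>^i * T}"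
    hence s: "\<tau> i < s" "s < \<tau> (Suc i)" by (auto simp: tau_Suc)
    hence "0 \<le> s" using tau_nonneg[of i] by linarith
    thus "0 < y s $ 3" using y3_pos[OF s] y by simp
  qed
  moreover have "0 < \<alpha>^i * T" using \<alpha> T by simp
  ultimately show "junction_time y t" unfolding junction_time_def t using y by auto
next
  assume J: "junction_time y t"
  hence t: "0 \<le> t" "y3 t = 0" using y by (auto simp: junction_time_def)
  from J obtain \<epsilon> where \<epsilon>: "\<epsilon> > 0" and side: "(\<forall>s\<in>{t<..<t + \<epsilon>}. 0 < y s $ 3) \<or> \<epsilon> \<le> t \<and> (\<forall>s\<in>{t - \<epsilon><..<t}. 0 < y s $ 3)"
    unfolding junction_time_def by blast
  show "t \<in> range \<tau>"
  proof (rule ccontr)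
    assume "t \<notin> range \<tau>"
    hence tinf: "\<tau>inf \<le> t" using y3_eq_0_iff t by blast
    from side show False
    proof
      assume "\<forall>s\<in>{t<..<t + \<epsilon>}. 0 < y s $ 3"
      hence "0 < y (t + \<epsilon>/2) $ 3" using \<epsilon> by simp
      thus False using y[of "t + \<epsilon>/2"] t tinf \<epsilon> by simp
    next
      assume L: "\<epsilon> \<le> t \<and> (\<forall>s\<in>{t - \<epsilon><..<t}. 0 < y s $ 3)"
      \<comment> \<open>A zero of \<open>y3\<close> in every left neighbourhood of \<open>t\<close>:
        some \<open>\<tau> i\<close> if \<open>t = \<tau>inf\<close>, otherwise a time at or after
        \<open>\<tau>inf\<close>.\<close>
      obtain s where s: "t - \<epsilon> < s" "s < t" "0 \<le> s" "y3 s = 0"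
      proof (cases "t = \<tau>inf")
        case True
        then obtain i where "t - \<epsilon> < \<tau> i" using ex_tau_greater[of "t - \<epsilon>"] \<epsilon> by auto
        thus ?thesis using that[of "\<tau> i"] tau_less_inf[of i] True by simp
      next
        case False
        have "max \<tau>inf (t - \<epsilon>/2) < t" "t - \<epsilon> < max \<tau>inf (t - \<epsilon>/2)" using False tinf \<epsilon> by auto
        thus ?thesis using that[of "max \<tau>inf (t - \<epsilon>/2)"] tau_inf_pos by simp
      qed
      thus False using L y[of s] by force
    qed
  qed
qed

lemma optimal_control_AE:
  assumes "optimal y v"
  shows "AE \<beta> in lborel.
    (\<beta> \<in> {0<..<\<beta>1} \<longrightarrow> v (\<tau> j + \<beta> * (\<alpha>^j * T)) = -1) \<and>
    (\<beta> \<in> {\<beta>1<..<\<beta>2} \<longrightarrow> v (\<tau> j + \<beta> * (\<alpha>^j * T)) = 1) \<and>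
    (\<beta> \<in> {\<beta>2<..<1} \<longrightarrow> v (\<tau> j + \<beta> * (\<alpha>^j * T)) = -1)"
proof -
  have aT: "0 < \<alpha>^j * T" using \<alpha> T by simp
  have "AE t in lborel. 0 < t \<and> t < \<tau>inf \<longrightarrow> v t = v0 t"
    using optimal_unique(1)[OF assms] by (simp add: AE_completion_iff)
  then obtain N where N: "{t. \<not> (0 < t \<and> t < \<tau>inf \<longrightarrow> v t = v0 t)} \<subseteq> N" "N \<in> null_sets lborel"
    by (auto simp: eventually_ae_filter)
  have "AE t in lborel. t \<notin> N" using N(2) by (rule AE_not_in)
  \<comment> \<open>The exceptional null set of times is pulled back along the affine
    parametrization of the interval.\<close>
  hence "AE \<beta> in lborel. \<tau> j + (\<alpha>^j * T) * \<beta> \<notin> N"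
    using aT \<alpha> N(2) by (intro AE_borel_affine) auto
  thus ?thesis
  proof eventually_elim
    case (elim \<beta>)
    have v: "v (\<tau> j + \<beta> * (\<alpha>^j * T)) = W (\<beta> * T)" if \<beta>: "0 < \<beta>" "\<beta> < 1"
    proof -
      let ?t = "\<tau> j + \<beta> * (\<alpha>^j * T)"
      have pos: "0 < \<beta> * (\<alpha>^j * T)" by (rule mult_pos_pos[OF \<beta>(1) aT])
      moreover have "\<beta> * (\<alpha>^j * T) < 1 * (\<alpha>^j * T)" by (rule mult_strict_right_mono[OF \<beta>(2) aT])
      ultimately have t: "\<tau> j \<le> ?t" "?t < \<tau> (Suc j)" unfolding tau_Suc by linarith+
      have "0 < ?t" using pos tau_nonneg[of j] by linarith
      moreover have "?t < \<tau>inf" using t tau_less_inf[of "Suc j"] by linarith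
      ultimately have "v ?t = v0 ?t" using elim N(1) by (auto simp: mult.commute)
      also have "\<dots> = W (\<beta> * T)" unfolding v0_def selfsim_block[OF t] using \<alpha> by simp
      finally show ?thesis .
    qed
    have W: "W (\<beta> * T) = (if \<beta> < \<beta>1 then -1 else if \<beta> < \<beta>2 then 1 else -1)"
      using T by (simp add: W_def)
    show ?case using v \<beta>_order unfolding W by auto
  qed
qed

text \<open>On the first arc the expression is a constant polynomial, equal to
  \<open>P2 0 - P1 0 = 0\<close>. Each switch adds or subtracts twice the Taylor expansion of
  \<open>P1\<close>, evaluated at that switch, which is a zero of \<open>P1\<close>.\<close>

lemma base_hamiltonian:
  "Y3 x + P1 x * W x + P2 x * Y1 x + P3 x * Y2 x = 0"
proof -
  define a b c where "a = \<beta>1*T" and "b = \<beta>2*T" and "c = \<beta>3*T"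
  have P: "6 * P1 x = - ((x - a) * (x - b) * (x - c))"
    "6 * P2 x = (x - b) * (x - c) + (x - a) * (x - c) + (x - a) * (x - b)"
    "3 * P3 x = a + b + c - 3 * x"
    unfolding P1_def P2_def P3_def a_def b_def c_def by (simp_all add: field_simps)
  have e: "a * b * c = b * c + a * c + a * b"
    using P1_eq_P2 unfolding P1_def P2_def a_def[symmetric] b_def[symmetric] c_def[symmetric] by simp
  \<comment> \<open>Taylor expansion of \<open>P1\<close> at \<open>x\<close>, evaluated at its zero \<open>z\<close>.\<close>
  have taylor: "P1 x + P2 x * (x - z) + P3 x * (x - z)^2 / 2 + (x - z)^3 / 6 = 0" if "z = a \<or> z = b" for z
  proof -
    have "6 * P1 x + 6 * P2 x * (x - z) + 3 * P3 x * (x - z)^2 + (x - z)^3 = 0"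
      using that
    proof
      assume z: "z = a"
      show ?thesis unfolding P z by algebra
    next
      assume z: "z = b"
      show ?thesis unfolding P z by algebra
    qed
    thus ?thesis by simp
  qed
  have start: "x^2/2 - x^3/6 - P1 x + P2 x * (1 - x) + P3 x * (x - x^2/2) = 0"
  proof -
    have "3 * x^2 - x^3 - 6 * P1 x + 6 * P2 x * (1 - x) + 3 * P3 x * (2 * x - x^2) = 0"
      unfolding P using e by algebra
    thus ?thesis by (simp add: field_simps)
  qed
  have ab: "a < b" using switch_order by (simp add: a_def b_def)
  have Y: "Y3 x = x^2/2 - x^3/6 + (max 0 (x - a))^3/3 - (max 0 (x - b))^3/3"
    "Y1 x = 1 - x + 2 * max 0 (x - a) - 2 * max 0 (x - b)"
    "Y2 x = x - x^2/2 + (max 0 (x - a))^2 - (max 0 (x - b))^2"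
    "W x = (if x < a then -1 else if x < b then 1 else -1)"
    unfolding Y1_def Y2_def Y3_def W_def a_def b_def by simp_all
  consider "x < a" | "a \<le> x" "x < b" | "b \<le> x" by linarith
  thus ?thesis
  proof cases
    case 1
    thus ?thesis using start ab unfolding Y by simp
  next
    case 2
    hence "Y3 x + P1 x * W x + P2 x * Y1 x + P3 x * Y2 x =
      (x^2/2 - x^3/6 - P1 x + P2 x * (1 - x) + P3 x * (x - x^2/2))
      + 2 * (P1 x + P2 x * (x - a) + P3 x * (x - a)^2 / 2 + (x - a)^3 / 6)"
      unfolding Y by (simp add: algebra_simps)
    thus ?thesis unfolding start using taylor[of a] by simp
  next
    case 3
    hence "Y3 x + P1 x * W x + P2 x * Y1 x + P3 x * Y2 x =
      (x^2/2 - x^3/6 - P1 x + P2 x * (1 - x) + P3 x * (x - x^2/2))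
      + 2 * (P1 x + P2 x * (x - a) + P3 x * (x - a)^2 / 2 + (x - a)^3 / 6)
      - 2 * (P1 x + P2 x * (x - b) + P3 x * (x - b)^2 / 2 + (x - b)^3 / 6)"
      using ab unfolding Y by (simp add: algebra_simps)
    thus ?thesis unfolding start using taylor[of a] taylor[of b] by simp
  qed
qed

lemma star_hamiltonian:
  assumes "0 \<le> t"
  shows "y3 t + q1 t * v0 t + q2 t * y1 t + q3 t * y2 t = 0"
proof (cases "t < \<tau>inf")
  case True
  then obtain i where i: "\<tau> i \<le> t" "t < \<tau> (Suc i)" using in_block assms by blast
  define a where "a = \<alpha>^i"
  define x where "x = (t - \<tau> i) / a"
  have pw: "(\<alpha>^3)^i = a^3" "(\<alpha>^2)^i = a^2"
    by (simp_all add: a_def power_mult[symmetric] mult.commute)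
  have "y3 t + q1 t * v0 t + q2 t * y1 t + q3 t * y2 t
    = a^3 * (Y3 x + P1 x * W x + P2 x * Y1 x + P3 x * Y2 x)"
    unfolding selfsim_defs selfsim_block[OF i] pw a_def[symmetric] x_def[symmetric]
    by (simp add: power2_eq_square power3_eq_cube algebra_simps)
  thus ?thesis unfolding base_hamiltonian by simp
qed (simp add: selfsim_defs)

section \<open>Regularity and jumps of the third costate, and the multiplier\<close>

lemma q3_block:
  assumes "\<tau> i \<le> t" "t < \<tau> (Suc i)"
  shows "q3 t = \<alpha>^i * P3 0 - (t - \<tau> i)"
  unfolding q3_def selfsim_block[OF assms] P3_def using \<alpha> by (simp add: field_simps)

text \<open>On block i the value is of order \<open>\<alpha>^i\<close>, and so is the remaining
  distance to \<open>\<tau>inf\<close>. This gives continuity at \<open>\<tau>inf\<close>, which is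
  required because \<open>\<tau>inf\<close> is not a junction time.\<close>

lemma q3_bound:
  obtains K where "\<And>t. 0 \<le> t \<Longrightarrow> \<bar>q3 t\<bar> \<le> K * \<bar>t - \<tau>inf\<bar>"
proof -
  define M where "M = \<bar>P3 0\<bar> + T"
  have M: "0 \<le> M" using T by (simp add: M_def)
  show ?thesis
  proof (rule that[of "M / (\<alpha> * \<tau>inf)"])
    fix t :: real assume "0 \<le> t"
    show "\<bar>q3 t\<bar> \<le> M / (\<alpha> * \<tau>inf) * \<bar>t - \<tau>inf\<bar>"
    proof (cases "t < \<tau>inf")
      case True
      then obtain i where i: "\<tau> i \<le> t" "t < \<tau> (Suc i)" using in_block \<open>0 \<le> t\<close> by blast
      have "\<bar>q3 t\<bar> \<le> \<alpha>^i * \<bar>P3 0\<bar> + \<bar>t - \<tau> i\<bar>"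
        unfolding q3_block[OF i] using \<alpha> by (intro order_trans[OF abs_triangle_ineq4]) (simp add: abs_mult)
      also have "\<dots> \<le> \<alpha>^i * M" unfolding M_def using i by (simp add: tau_Suc distrib_left)
      also have "\<alpha>^i * M = M / (\<alpha> * \<tau>inf) * (\<alpha>^Suc i * \<tau>inf)"
        using \<alpha> T by simp
      also have "\<dots> \<le> M / (\<alpha> * \<tau>inf) * \<bar>t - \<tau>inf\<bar>"
        using i(2) tau_alt[of "Suc i"] M \<alpha> T by (intro mult_left_mono) auto
      finally show ?thesis .
    next
      case False
      thus ?thesis using M \<alpha> T by (simp add: q3_def)
    qed
  qed
qed

lemma q3_continuous:
  assumes t: "0 \<le> t" and nj: "\<not> (0 < t \<and> t \<in> range \<tau>)"
  shows "continuous (at t within {0..}) q3"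
proof -
  consider "t < \<tau>inf" | "t = \<tau>inf" | "\<tau>inf < t" by linarith
  thus ?thesis
  proof cases
    case 1
    then obtain i where i: "\<tau> i \<le> t" "t < \<tau> (Suc i)" using in_block t by blast
    have c: "continuous (at t within {0..}) (\<lambda>t. \<alpha>^i * P3 0 - (t - \<tau> i))" by (intro continuous_intros)
    define \<delta> where "\<delta> = (if t = 0 then \<tau> (Suc i) else min (t - \<tau> i) (\<tau> (Suc i) - t))"
    have ti: "t \<noteq> \<tau> i" if "t \<noteq> 0" using nj that t by auto
    have "0 < \<delta>" using i ti t tau_nonneg[of i] unfolding \<delta>_def by (auto simp: less_le)
    show ?thesis
    proof (rule continuous_transform_within[OF c \<open>0 < \<delta>\<close>])
      fix s :: real assume s: "s \<in> {0..}" "dist s t < \<delta>"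
      have "\<tau> i \<le> s \<and> s < \<tau> (Suc i)"
      proof (cases "t = 0")
        case True
        hence "\<tau> i = 0" using i tau_nonneg[of i] by linarith
        thus ?thesis using s True by (simp add: \<delta>_def dist_real_def)
      next
        case False
        thus ?thesis using s by (auto simp: \<delta>_def dist_real_def abs_less_iff)
      qed
      thus "\<alpha>^i * P3 0 - (s - \<tau> i) = q3 s" using q3_block[of i s] by simp
    qed (use t in simp)
  next
    case 2
    obtain K where K: "\<And>t. 0 \<le> t \<Longrightarrow> \<bar>q3 t\<bar> \<le> K * \<bar>t - \<tau>inf\<bar>" using q3_bound by blast
    have "(q3 \<longlongrightarrow> 0) (at t within {0..})"
    proof (rule Lim_null_comparison)
      show "\<forall>\<^sub>F s in at t within {0..}. norm (q3 s) \<le> K * \<bar>s - \<tau>inf\<bar>"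
        unfolding eventually_at_filter using K by (intro always_eventually) auto
      have "((\<lambda>s. K * \<bar>s - \<tau>inf\<bar>) \<longlongrightarrow> K * \<bar>t - \<tau>inf\<bar>) (at t within {0..})"
        by (intro tendsto_intros)
      thus "((\<lambda>s. K * \<bar>s - \<tau>inf\<bar>) \<longlongrightarrow> 0) (at t within {0..})" using 2 by simp
    qed
    moreover have "q3 t = 0" using 2 by (simp add: q3_def)
    ultimately show ?thesis by (simp add: continuous_within)
  next
    case 3
    have c: "continuous (at t within {0..}) (\<lambda>_. 0 :: real)" by simp
    show ?thesis
      by (rule continuous_transform_within[OF c, of "t - \<tau>inf"]) (use 3 t in \<open>auto simp: q3_def dist_real_def\<close>)
  qed
qed

text \<open>An interval free of positive junctions lies either in one block or beyond
  \<open>\<tau>inf\<close>. There the multiplier must equal \<open>p0 = 1\<close> to keep the third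
  costate at 0.\<close>

lemma q3_integral:
  assumes "0 \<le> a" "a \<le> b" and nj: "\<And>t. t \<in> {a..b} \<Longrightarrow> 0 < t \<Longrightarrow> t \<notin> range \<tau>"
  shows "((\<lambda>s. - 1 + (if \<tau>inf \<le> s then 1 else 0)) has_integral q3 b - q3 a) {a..b}"
proof (cases "a < \<tau>inf")
  case True
  then obtain i where i: "\<tau> i \<le> a" "a < \<tau> (Suc i)" using in_block assms by blast
  have b: "b < \<tau> (Suc i)"
  proof (rule ccontr)
    assume "\<not> b < \<tau> (Suc i)"
    moreover have "0 < \<tau> (Suc i)" using tau_less_iff[of 0 "Suc i"] by simp
    ultimately show False using nj[of "\<tau> (Suc i)"] i by auto
  qed
  have "q3 b - q3 a = - 1 * (b - a)" using q3_block[of i a] q3_block[of i b] i b assms by simp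
  moreover have "((\<lambda>s. - 1) has_integral - 1 * (b - a)) {a..b}"
    using has_integral_const_real[of "- 1 :: real" a b] assms by simp
  ultimately have "((\<lambda>s. - 1) has_integral q3 b - q3 a) {a..b}" by simp
  thus ?thesis
    by (rule has_integral_eq[rotated]) (use b tau_less_inf[of "Suc i"] in auto)
next
  case False
  have "((\<lambda>s. 0) has_integral q3 b - q3 a) {a..b}" using False assms by (simp add: q3_def)
  thus ?thesis by (rule has_integral_eq[rotated]) (use False in auto)
qed

lemma q3_jump:
  "(q3 \<longlongrightarrow> \<alpha>^i * P3 T) (at_left (\<tau> (Suc i)))" "(q3 \<longlongrightarrow> \<alpha>^Suc i * P3 0) (at_right (\<tau> (Suc i)))"
proof -
  have A: "((\<lambda>t. \<alpha>^i * P3 0 - (t - \<tau> i)) \<longlongrightarrow> \<alpha>^i * P3 0 - (\<tau> (Suc i) - \<tau> i)) (at_left (\<tau> (Suc i)))"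
    by (intro tendsto_intros)
  have e: "\<alpha>^i * P3 0 - (\<tau> (Suc i) - \<tau> i) = \<alpha>^i * P3 T"
    by (simp add: tau_Suc P3_def algebra_simps)
  have "\<forall>\<^sub>F t in at_left (\<tau> (Suc i)). \<alpha>^i * P3 0 - (t - \<tau> i) = q3 t"
    by (rule eventually_mono[OF eventually_at_left_real[of "\<tau> i" "\<tau> (Suc i)"]])
      (auto simp: q3_block[of i])
  thus "(q3 \<longlongrightarrow> \<alpha>^i * P3 T) (at_left (\<tau> (Suc i)))"
    by (rule Lim_transform_eventually[OF A[unfolded e]])
  have A': "((\<lambda>t. \<alpha>^Suc i * P3 0 - (t - \<tau> (Suc i))) \<longlongrightarrow> \<alpha>^Suc i * P3 0 - (\<tau> (Suc i) - \<tau> (Suc i))) (at_right (\<tau> (Suc i)))"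
    by (intro tendsto_intros)
  have e': "\<alpha>^Suc i * P3 0 - (\<tau> (Suc i) - \<tau> (Suc i)) = \<alpha>^Suc i * P3 0" by simp
  have "\<forall>\<^sub>F t in at_right (\<tau> (Suc i)). \<alpha>^Suc i * P3 0 - (t - \<tau> (Suc i)) = q3 t"
    by (rule eventually_mono[OF eventually_at_right_real[of "\<tau> (Suc i)" "\<tau> (Suc (Suc i))"]])
      (auto simp del: power_Suc simp: q3_block[of "Suc i"])
  thus "(q3 \<longlongrightarrow> \<alpha>^Suc i * P3 0) (at_right (\<tau> (Suc i)))"
    by (rule Lim_transform_eventually[OF A'[unfolded e']])
qed

definition qstar :: "real \<Rightarrow> real^3" where "qstar t = vector [q1 t, q2 t, q3 t]"

lemma qstar_nth [simp]: "qstar t $ 1 = q1 t" "qstar t $ 2 = q2 t" "qstar t $ 3 = q3 t"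
  by (simp_all add: qstar_def)

lemma qstar_costate:
  assumes opt: "optimal y v"
  shows "costate_multiplier y v 1 qstar (\<lambda>t. if \<tau>inf \<le> t then 1 else 0)"
proof -
  note U = optimal_unique[OF opt]
  have J: "junction_time y t \<longleftrightarrow> t \<in> range \<tau>" for t using U(3) by (rule junction_time_iff)
  have jump: "\<exists>l r. (q3 \<longlongrightarrow> l) (at_left t) \<and> (q3 \<longlongrightarrow> r) (at_right t) \<and> r - l \<ge> 0"
    if t: "0 < t" "t \<in> range \<tau>" for t
  proof -
    from t(2) obtain k where k: "t = \<tau> k" by blast
    with t(1) obtain i where i: "t = \<tau> (Suc i)" by (cases k) auto
    have "\<alpha>^i * P3 T \<le> \<alpha>^i * (\<alpha> * P3 0)" using P3_jump \<alpha> by (intro mult_left_mono) auto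
    thus ?thesis using q3_jump[of i] unfolding i by (intro exI conjI) (auto simp: ac_simps)
  qed
  have "AE t in lebesgue. t > 0 \<longrightarrow>
      hamiltonian 1 (qstar t) (if \<tau>inf \<le> t then 1 else 0) (y t) (v t) = 0 \<and>
      (\<forall>w\<in>{-1..1}. hamiltonian 1 (qstar t) (if \<tau>inf \<le> t then 1 else 0) (y t) (v t)
        \<le> hamiltonian 1 (qstar t) (if \<tau>inf \<le> t then 1 else 0) (y t) w)"
    using U(1)
  proof eventually_elim
    case (elim t)
    show ?case
    proof (intro impI)
      assume t: "0 < t"
      show "hamiltonian 1 (qstar t) (if \<tau>inf \<le> t then 1 else 0) (y t) (v t) = 0 \<and>
      (\<forall>w\<in>{-1..1}. hamiltonian 1 (qstar t) (if \<tau>inf \<le> t then 1 else 0) (y t) (v t)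
        \<le> hamiltonian 1 (qstar t) (if \<tau>inf \<le> t then 1 else 0) (y t) w)"
      proof (cases "t < \<tau>inf")
        case True
        have y: "y t = ystar t" and v: "v t = v0 t" using U(2)[of t] elim t True by auto
        have H: "hamiltonian 1 (qstar t) (if \<tau>inf \<le> t then 1 else 0) (y t) w = q1 t * (w - v0 t)" for w
          using True star_hamiltonian[of t] t unfolding hamiltonian_def y by (simp add: algebra_simps)
        show ?thesis unfolding H v using q1_sign(1)[of t] t by auto
      next
        \<comment> \<open>Beyond \<open>\<tau>inf\<close> nothing is known about \<open>v\<close>
          and the first two state components, but the costates vanish and the two terms in
          \<open>y t $ 3\<close> cancel.\<close>
        case False
        thus ?thesis by (simp add: hamiltonian_def selfsim_defs)
      qed
    qed
  qed
  thus ?thesis unfolding costate_multiplier_def J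
    using U(3) q_integrals q3_integral q3_continuous jump by (auto simp: zero_prod_def)
qed

end

text \<open>A negative value would persist on a nonempty open interval, which is not negligible. The
  closed endpoints matter: this carries sign conditions from the arcs to the switches and the
  junction.\<close>

lemma AE_nonneg_imp_nonneg:
  fixes f :: "real \<Rightarrow> real"
  assumes cont: "continuous_on {a..b} f" and ae: "AE t in lebesgue. t \<in> {a<..<b} \<longrightarrow> 0 \<le> f t"
    and t: "t \<in> {a..b}" and ab: "a < b"
  shows "0 \<le> f t"
proof (rule ccontr)
  assume "\<not> 0 \<le> f t"
  hence neg: "f t < 0" by simp
  have "(f \<longlongrightarrow> f t) (at t within {a..b})" using cont t by (auto simp: continuous_on_def)
  hence "eventually (\<lambda>s. f s < 0) (at t within {a..b})" by (rule order_tendstoD(2)[OF _ neg])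
  then obtain \<delta> where \<delta>: "\<delta> > 0" "\<And>s. s \<in> {a..b} \<Longrightarrow> dist s t < \<delta> \<Longrightarrow> f s < 0"
    unfolding eventually_at using neg by (metis dist_self)
  define J where "J = {max a (t - \<delta>)<..<min b (t + \<delta>)}"
  have negJ: "f s < 0" if "s \<in> J" for s
    using that by (intro \<delta>) (auto simp: J_def dist_real_def)
  from ae have "AE s in lebesgue. s \<notin> J"
    by eventually_elim (use negJ in \<open>force simp: J_def\<close>)
  moreover have "J \<in> sets lebesgue" by (simp add: J_def)
  ultimately have "negligible J"
    by (simp add: negligible_iff_null_sets AE_iff_null_sets)
  moreover have "max a (t - \<delta>) < min b (t + \<delta>)" using t ab \<delta>(1) by auto
  hence "J \<noteq> {}" unfolding J_def greaterThanLessThan_empty_iff not_le .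
  moreover have "open J" by (simp add: J_def)
  ultimately show False using open_not_negligible by blast
qed

lemma primitive_eq:
  fixes f F g G :: "real \<Rightarrow> real"
  assumes F: "\<And>t. t \<in> {a..b} \<Longrightarrow> (f has_integral F t - F a) {a..t}"
    and fg: "\<And>s. a < s \<Longrightarrow> s < b \<Longrightarrow> f s = g s"
    and G: "\<And>s. (G has_real_derivative g s) (at s)" and t: "t \<in> {a..b}"
  shows "F t = F a + (G t - G a)"
proof -
  have "(g has_integral G t - G a) {a..t}"
    by (rule fundamental_theorem_of_calculus)
      (use t G in \<open>auto simp: has_real_derivative_iff_has_vector_derivative[symmetric] intro: has_field_derivative_at_within\<close>)
  moreover have "(g has_integral F t - F a) {a..t}"
    by (rule has_integral_spike_finite[OF _ _ F[OF t], of "{a, t}"]) (use t fg in auto)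
  ultimately have "G t - G a = F t - F a" by (rule has_integral_unique)
  thus ?thesis by simp
qed

section \<open>Determination of an arbitrary costate between junctions\<close>

context chattering
begin

lemma switch_determinant: "\<beta>1 * \<beta>2 * T - (\<beta>1 + \<beta>2) \<noteq> 0"
proof
  assume "\<beta>1 * \<beta>2 * T - (\<beta>1 + \<beta>2) = 0"
  moreover have "\<beta>3 * (\<beta>1 * \<beta>2 * T - (\<beta>1 + \<beta>2)) = \<beta>1 * \<beta>2"
    using beta_system_hamiltonian[OF sys] by (simp add: algebra_simps)
  ultimately show False using \<beta>_order by simp
qed

text \<open>The hypothesis \<open>C1 = L * C2\<close> is the Hamiltonian at a left junction with
  state L e1 and control -1. Together with the two switches it is a linear system for the
  coefficients, whose solvability rests on \<open>switch_determinant\<close>. The case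
  \<open>p0 = 0\<close> is included and gives the zero polynomial.\<close>

lemma cubic_determined:
  fixes C1 C2 C3 p0 :: real
  defines "p \<equiv> \<lambda>x. C1 - C2 * x + C3 * x^2 / 2 - p0 * x^3 / 6"
  assumes L: "0 < L" and z: "p (\<beta>1 * (L * T)) = 0" "p (\<beta>2 * (L * T)) = 0" and H: "C1 = L * C2"
  shows "p x = - p0 / 6 * ((x - \<beta>1 * (L * T)) * (x - \<beta>2 * (L * T)) * (x - \<beta>3 * (L * T)))"
proof -
  define a b c where "a = \<beta>1 * (L * T)" and "b = \<beta>2 * (L * T)" and "c = \<beta>3 * (L * T)"
  have ab: "a \<noteq> b" using \<beta>_order L T by (simp add: a_def b_def)
  have abL: "a * b - L * (a + b) \<noteq> 0"
  proof -
    have "a * b - L * (a + b) = L^2 * T * (\<beta>1 * \<beta>2 * T - (\<beta>1 + \<beta>2))"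
      unfolding a_def b_def by (simp add: power2_eq_square algebra_simps)
    thus ?thesis using switch_determinant L T by simp
  qed
  have abc: "a * b * c = L * (b * c + a * c + a * b)"
  proof -
    have "a * b * c = L^3 * T^2 * (T * (\<beta>1 * \<beta>2 * \<beta>3))"
      unfolding a_def b_def c_def by (simp add: power2_eq_square power3_eq_cube algebra_simps)
    also have "\<dots> = L * (b * c + a * c + a * b)"
      unfolding beta_system_hamiltonian[OF sys] a_def b_def c_def
      by (simp add: power2_eq_square power3_eq_cube algebra_simps)
    finally show ?thesis .
  qed
  \<comment> \<open>Subtracting the expected cubic leaves a quadratic vanishing at both switches.\<close>
  define A where "A = 6 * C1 - p0 * (a * b * c)"
  define B where "B = 6 * C2 - p0 * (b * c + a * c + a * b)"
  define C where "C = 3 * C3 - p0 * (a + b + c)"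
  have p: "6 * p x = A - B * x + C * x^2 - p0 * ((x - a) * (x - b) * (x - c))" for x
    unfolding p_def A_def B_def C_def by (simp add: field_simps power2_eq_square power3_eq_cube)
  have za: "A - B * a + C * a^2 = 0" using p[of a] z(1) by (simp add: a_def[symmetric])
  have zb: "A - B * b + C * b^2 = 0" using p[of b] z(2) by (simp add: b_def[symmetric])
  have AB: "A = L * B" unfolding A_def B_def H abc by (simp add: algebra_simps)
  have "(a - b) * (C * (a + b) - B) = 0" using za zb by algebra
  hence B: "B = C * (a + b)" using ab by simp
  have "C * (a * b - L * (a + b)) = 0" using za AB B by algebra
  hence "C = 0" using abL by simp
  hence "6 * p x = - p0 * ((x - a) * (x - b) * (x - c))" using p AB B by simp
  thus ?thesis by (simp add: a_def b_def c_def)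
qed

lemma costate_unique:
  assumes opt: "optimal y v" and cm: "costate_multiplier y v p0 p \<zeta>"
    and J: "\<And>t. junction_time y t \<longleftrightarrow> t \<in> range \<tau>"
    and t: "\<tau> j < t" "t < \<tau> (Suc j)"
  shows "p t $ 1 = - p0 / 6 * ((t - \<tau> j - \<beta>1 * (\<alpha>^j * T)) * (t - \<tau> j - \<beta>2 * (\<alpha>^j * T)) * (t - \<tau> j - \<beta>3 * (\<alpha>^j * T)))"
    "((\<lambda>s. p s $ 1) has_real_derivative - p t $ 2) (at t)"
    "((\<lambda>s. p s $ 2) has_real_derivative - p t $ 3) (at t)"
proof -
  note U = optimal_unique[OF opt]
  define a where "a = \<tau> j"
  define b where "b = \<tau> (Suc j)"
  define L where "L = \<alpha>^j"
  have L: "0 < L" using \<alpha> by (simp add: L_def)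
  have LT: "0 < L * T" using L T by simp
  have a0: "0 \<le> a" by (simp add: a_def)
  have b: "b = a + L * T" by (simp add: a_def b_def L_def tau_Suc)
  have binf: "b < \<tau>inf" unfolding b_def by (rule tau_less_inf)
  have ab: "a < b" using LT b by simp
  have P1: "((\<lambda>s. - p s $ 2) has_integral p t $ 1 - p 0 $ 1) {0..t}"
    and P2: "((\<lambda>s. - p s $ 3) has_integral p t $ 2 - p 0 $ 2) {0..t}" if "0 \<le> t" for t
    using cm that unfolding costate_multiplier_def by blast+
  have \<zeta>: "\<zeta> s = 0" if "a < s" "s < b" for s
  proof -
    have s: "0 < s" using that a0 by simp
    hence "0 < y s $ 3" using y3_pos[of j s] that U(3)[of s] by (simp add: a_def b_def)
    moreover have "\<zeta> s * y s $ 3 = 0" using cm s unfolding costate_multiplier_def by blast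
    ultimately show ?thesis by simp
  qed
  have p3_diff: "p s' $ 3 - p s $ 3 = - p0 * (s' - s)" if s: "a < s" "s \<le> s'" "s' < b" for s s'
  proof -
    have "\<not> junction_time y r" if "r \<in> {s..s'}" for r
    proof
      assume "junction_time y r"
      then obtain k where "r = \<tau> k" using J by blast
      hence "a < \<tau> k" "\<tau> k < b" using that s by auto
      thus False by (simp add: a_def b_def)
    qed
    moreover have "\<forall>a b. 0 \<le> a \<and> a \<le> b \<and> (\<forall>t\<in>{a..b}. t > 0 \<longrightarrow> \<not> junction_time y t) \<longrightarrow>
        ((\<lambda>s. - p0 + \<zeta> s) has_integral (p b $ 3 - p a $ 3)) {a..b}"
      using cm unfolding costate_multiplier_def by blast
    ultimately have "((\<lambda>r. - p0 + \<zeta> r) has_integral p s' $ 3 - p s $ 3) {s..s'}"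
      using s a0 by simp
    hence "((\<lambda>r. - p0) has_integral p s' $ 3 - p s $ 3) {s..s'}"
      by (rule has_integral_eq[rotated]) (use \<zeta> s in auto)
    moreover have "((\<lambda>r. - p0) has_integral - p0 * (s' - s)) {s..s'}"
      using has_integral_const_real[of "- p0" s s'] s by (simp add: mult.commute)
    ultimately show ?thesis by (rule has_integral_unique)
  qed
  \<comment> \<open>An interior base point, since \<open>p3\<close> may jump at \<open>a\<close> and
    \<open>b\<close> and its values there are not tied to the open interval. The constant
    \<open>C3\<close> below is its limit from the right at \<open>a\<close>.\<close>
  define m where "m = (a + b) / 2"
  have m: "a < m" "m < b" using ab by (auto simp: m_def)
  define C3 where "C3 = p m $ 3 + p0 * (m - a)"
  have p3: "p s $ 3 = C3 - p0 * (s - a)" if s: "a < s" "s < b" for s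
    using p3_diff[of s m] p3_diff[of m s] s m unfolding C3_def
    by (cases "s \<le> m") (auto simp: algebra_simps)
  define C2 where "C2 = p a $ 2"
  have p2: "p s $ 2 = C2 - C3 * (s - a) + p0 * (s - a)^2 / 2" if s: "s \<in> {a..b}" for s
  proof -
    have "p s $ 2 = p a $ 2 + ((- C3 * (s - a) + p0 * (s - a)^2 / 2) - (- C3 * (a - a) + p0 * (a - a)^2 / 2))"
    proof (rule primitive_eq[OF _ _ _ s, where f = "\<lambda>s. - p s $ 3" and g = "\<lambda>s. - C3 + p0 * (s - a)"])
      show "((\<lambda>s. - p s $ 3) has_integral p t $ 2 - p a $ 2) {a..t}" if "t \<in> {a..b}" for t
        by (rule primitive_increment[OF P2 a0]) (use that in auto)
    qed (use p3 in \<open>auto intro!: derivative_eq_intros\<close>)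
    thus ?thesis by (simp add: C2_def)
  qed
  define C1 where "C1 = p a $ 1"
  define f where "f x = C1 - C2 * x + C3 * x^2 / 2 - p0 * x^3 / 6" for x
  have p1: "p s $ 1 = f (s - a)" if s: "s \<in> {a..b}" for s
  proof -
    define G where "G s = - C2 * (s - a) + C3 * (s - a)^2 / 2 - p0 * (s - a)^3 / 6" for s
    have "p s $ 1 = p a $ 1 + (G s - G a)"
    proof (rule primitive_eq[OF _ _ _ s, where f = "\<lambda>s. - p s $ 2" and g = "\<lambda>s. - (C2 - C3 * (s - a) + p0 * (s - a)^2 / 2)"])
      show "((\<lambda>s. - p s $ 2) has_integral p t $ 1 - p a $ 1) {a..t}" if "t \<in> {a..b}" for t
        by (rule primitive_increment[OF P1 a0]) (use that in auto)
      show "(G has_real_derivative - (C2 - C3 * (s - a) + p0 * (s - a)^2 / 2)) (at s)" for s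
        unfolding G_def [abs_def] by (auto intro!: derivative_eq_intros simp: power2_eq_square field_simps)
    qed (use p2 in auto)
    thus ?thesis by (simp add: G_def f_def C1_def)
  qed
  have contf: "continuous_on S (\<lambda>s. f (s - a))" for S
    unfolding f_def by (intro continuous_intros) auto
  have ae: "AE s in lebesgue. a < s \<and> s < b \<longrightarrow> v s = v0 s \<and>
      hamiltonian p0 (p s) (\<zeta> s) (y s) (v s) = 0 \<and>
      (\<forall>w\<in>{-1..1}. hamiltonian p0 (p s) (\<zeta> s) (y s) (v s) \<le> hamiltonian p0 (p s) (\<zeta> s) (y s) w)"
  proof -
    have "AE s in lebesgue. s > 0 \<longrightarrow> hamiltonian p0 (p s) (\<zeta> s) (y s) (v s) = 0 \<and>
      (\<forall>w\<in>{-1..1}. hamiltonian p0 (p s) (\<zeta> s) (y s) (v s) \<le> hamiltonian p0 (p s) (\<zeta> s) (y s) w)"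
      using cm unfolding costate_multiplier_def by blast
    with U(1) show ?thesis by eventually_elim (use a0 binf in auto)
  qed
  have v0: "v0 s = W ((s - a) / L)" if "a < s" "s < b" for s
    unfolding v0_def using that selfsim_block[of j s 1 W] by (simp add: a_def b_def L_def)
  define x1 where "x1 = a + \<beta>1 * (L * T)"
  define x2 where "x2 = a + \<beta>2 * (L * T)"
  have ord: "a < x1" "x1 < x2" "x2 < b"
    using mult_pos_pos[OF \<beta>_order(1) LT] mult_strict_right_mono[OF \<beta>_order(2) LT]
      mult_strict_right_mono[OF \<beta>_order(3) LT] unfolding x1_def x2_def b by simp_all
  have W: "W ((s - a) / L) = (if s < x1 then -1 else if s < x2 then 1 else -1)" for s
    using L unfolding W_def x1_def x2_def by (simp add: field_simps)
  have sgn1: "0 \<le> p s $ 1 * (w - W ((s - a) / L))" if w: "\<bar>w\<bar> \<le> 1"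
    and h: "\<forall>w\<in>{-1..1}. hamiltonian p0 (p s) (\<zeta> s) (y s) (v s) \<le> hamiltonian p0 (p s) (\<zeta> s) (y s) w"
    and v: "v s = W ((s - a) / L)" for s w
  proof -
    have "w \<in> {-1..1}" using w by auto
    from h[rule_format, OF this] show ?thesis
      unfolding v[symmetric] by (simp add: hamiltonian_def algebra_simps)
  qed
  \<comment> \<open>Minimization makes the cubic nonnegative on the outer arcs and nonpositive on
    the middle one. By continuity both signs hold at each switch, so the switches are zeros.\<close>
  have pos1: "0 \<le> f (x1 - a)"
  proof (rule AE_nonneg_imp_nonneg[where a = a and b = x1, OF contf])
    show "AE s in lebesgue. s \<in> {a<..<x1} \<longrightarrow> 0 \<le> f (s - a)" using ae
    proof eventually_elim
      case (elim s)
      show ?case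
      proof
        assume s: "s \<in> {a<..<x1}"
        hence "0 \<le> p s $ 1 * (1 - W ((s - a) / L))"
          using elim v0[of s] ord by (intro sgn1) auto
        thus "0 \<le> f (s - a)" using s ord p1[of s] by (simp add: W)
      qed
    qed
  qed (use ord in auto)
  have neg: "0 \<le> - f (s - a)" if "s \<in> {x1..x2}" for s
  proof (rule AE_nonneg_imp_nonneg[where a = x1 and b = x2 and f = "\<lambda>s. - f (s - a)"])
    show "AE s in lebesgue. s \<in> {x1<..<x2} \<longrightarrow> 0 \<le> - f (s - a)" using ae
    proof eventually_elim
      case (elim s)
      show ?case
      proof
        assume s: "s \<in> {x1<..<x2}"
        hence "0 \<le> p s $ 1 * (- 1 - W ((s - a) / L))"
          using elim v0[of s] ord by (intro sgn1) auto
        thus "0 \<le> - f (s - a)" using s ord p1[of s] by (simp add: W)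
      qed
    qed
  qed (use ord that in \<open>auto intro!: continuous_intros contf\<close>)
  have pos2: "0 \<le> f (x2 - a)"
  proof (rule AE_nonneg_imp_nonneg[where a = x2 and b = b, OF contf])
    show "AE s in lebesgue. s \<in> {x2<..<b} \<longrightarrow> 0 \<le> f (s - a)" using ae
    proof eventually_elim
      case (elim s)
      show ?case
      proof
        assume s: "s \<in> {x2<..<b}"
        hence "0 \<le> p s $ 1 * (1 - W ((s - a) / L))"
          using elim v0[of s] ord by (intro sgn1) auto
        thus "0 \<le> f (s - a)" using s ord p1[of s] by (simp add: W)
      qed
    qed
  qed (use ord in auto)
  have z1: "f (\<beta>1 * (L * T)) = 0" using pos1 neg[of x1] ord by (simp add: x1_def)
  have z2: "f (\<beta>2 * (L * T)) = 0" using pos2 neg[of x2] ord by (simp add: x2_def)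
  \<comment> \<open>The Hamiltonian on the first arc, with control -1 and the polynomial forms of
    the costates. Unlike the original expression it is continuous up to \<open>a\<close>, where it
    equals \<open>- C1 + C2 * L\<close>.\<close>
  define h where "h s = p0 * y3 s - f (s - a) + (C2 - C3 * (s - a) + p0 * (s - a)^2 / 2) * y1 s
      + (C3 - p0 * (s - a)) * y2 s" for s
  have cy: "continuous_on {a..x1} y1" "continuous_on {a..x1} y2" "continuous_on {a..x1} y3"
    by (rule continuous_on_subset[OF primitive_continuous[OF y_integrals(1), of x1]]
        continuous_on_subset[OF primitive_continuous[OF y_integrals(2), of x1]]
        continuous_on_subset[OF primitive_continuous[OF y_integrals(3), of x1]]; use a0 in auto)+
  have ch: "continuous_on {a..x1} h" unfolding h_def
    by (intro continuous_intros contf cy) auto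
  have h0: "AE s in lebesgue. s \<in> {a<..<x1} \<longrightarrow> h s = 0" using ae
  proof eventually_elim
    case (elim s)
    show ?case
    proof
      assume s: "s \<in> {a<..<x1}"
      hence s': "a < s" "s < b" using ord by auto
      have y: "y s = ystar s" using U(2)[of s] s' a0 binf by simp
      have v: "v s = -1" using elim s s' v0[of s] by (simp add: W)
      have "hamiltonian p0 (p s) (\<zeta> s) (y s) (v s) = 0" using elim s' by blast
      thus "h s = 0" using s' \<zeta>[of s] p3[of s] p2[of s] p1[of s]
        unfolding hamiltonian_def y v h_def by simp
    qed
  qed
  have "0 \<le> h a" by (rule AE_nonneg_imp_nonneg[OF ch]) (use h0 ord in \<open>auto elim!: eventually_mono\<close>)
  moreover have "0 \<le> - h a"
    by (rule AE_nonneg_imp_nonneg[where a = a and b = x1 and f = "\<lambda>s. - h s"])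
      (use h0 ord ch in \<open>auto elim!: eventually_mono intro!: continuous_intros\<close>)
  ultimately have "h a = 0" by simp
  hence "C1 = L * C2" unfolding h_def f_def by (simp add: a_def L_def mult.commute)
  from cubic_determined[OF L z1[unfolded f_def] z2[unfolded f_def] this]
  have f: "f x = - p0 / 6 * ((x - \<beta>1 * (L * T)) * (x - \<beta>2 * (L * T)) * (x - \<beta>3 * (L * T)))" for x
    unfolding f_def .
  have tab: "t \<in> {a<..<b}" using t by (simp add: a_def b_def)
  show "p t $ 1 = - p0 / 6 * ((t - \<tau> j - \<beta>1 * (\<alpha>^j * T)) * (t - \<tau> j - \<beta>2 * (\<alpha>^j * T)) * (t - \<tau> j - \<beta>3 * (\<alpha>^j * T)))"
    using p1[of t] tab f[of "t - a"] by (simp add: a_def L_def)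
  have "((\<lambda>s. f (s - a)) has_real_derivative - (C2 - C3 * (t - a) + p0 * (t - a)^2 / 2)) (at t)"
    unfolding f_def by (auto intro!: derivative_eq_intros simp: power2_eq_square field_simps)
  hence "((\<lambda>s. p s $ 1) has_real_derivative - (C2 - C3 * (t - a) + p0 * (t - a)^2 / 2)) (at t)"
    by (rule has_field_derivative_transform_within_open[of _ _ _ "{a<..<b}"]) (use tab p1 in auto)
  thus "((\<lambda>s. p s $ 1) has_real_derivative - p t $ 2) (at t)" using p2[of t] tab by simp
  have "((\<lambda>s. C2 - C3 * (s - a) + p0 * (s - a)^2 / 2) has_real_derivative - (C3 - p0 * (t - a))) (at t)"
    by (auto intro!: derivative_eq_intros simp: power2_eq_square field_simps)
  hence "((\<lambda>s. p s $ 2) has_real_derivative - (C3 - p0 * (t - a))) (at t)"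
    by (rule has_field_derivative_transform_within_open[of _ _ _ "{a<..<b}"]) (use tab p2 in auto)
  thus "((\<lambda>s. p s $ 2) has_real_derivative - p t $ 3) (at t)" using p3[of t] tab by simp
qed

end

theorem theorem4:
  shows "\<exists>\<alpha> T Tinf \<beta>1 \<beta>2 \<beta>3 :: real.
    beta_system \<alpha> T Tinf \<beta>1 \<beta>2 \<beta>3 \<and>
    (\<forall>\<alpha>' T' Tinf' \<beta>1' \<beta>2' \<beta>3'. beta_system \<alpha>' T' Tinf' \<beta>1' \<beta>2' \<beta>3' \<longrightarrow>
       \<alpha>' = \<alpha> \<and> T' = T \<and> Tinf' = Tinf \<and> \<beta>1' = \<beta>1 \<and> \<beta>2' = \<beta>2 \<and> \<beta>3' = \<beta>3) \<and>
    \<bar>\<alpha> - 0.1660687\<bar> \<le> 5 / 10^8 \<and>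
    \<bar>T - 4.2479105\<bar> \<le> 5 / 10^8 \<and>
    \<bar>Tinf - 5.0938372\<bar> \<le> 5 / 10^8 \<and>
    \<bar>\<beta>1 - 0.4698574\<bar> \<le> 5 / 10^8 \<and>
    \<bar>\<beta>2 - 0.8716996\<bar> \<le> 5 / 10^8 \<and>
    \<bar>\<beta>3 - 1.0283610\<bar> \<le> 5 / 10^8 \<and>
    (\<exists>y v. optimal y v) \<and>
    (\<forall>y v. optimal y v \<longrightarrow>
       (\<forall>i. y (tau \<alpha> T i) = \<alpha>^i *\<^sub>R axis 1 1) \<and>
       {t. junction_time y t} = range (tau \<alpha> T) \<and>
       (\<forall>i\<ge>1. AE \<beta> in lborel.
          (\<beta> \<in> {0<..<\<beta>1} \<longrightarrow> v ((1 - \<beta>) * tau \<alpha> T (i - 1) + \<beta> * tau \<alpha> T i) = -1) \<and>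
          (\<beta> \<in> {\<beta>1<..<\<beta>2} \<longrightarrow> v ((1 - \<beta>) * tau \<alpha> T (i - 1) + \<beta> * tau \<alpha> T i) = 1) \<and>
          (\<beta> \<in> {\<beta>2<..<1} \<longrightarrow> v ((1 - \<beta>) * tau \<alpha> T (i - 1) + \<beta> * tau \<alpha> T i) = -1)) \<and>
       (\<exists>p0 p \<zeta>. costate_multiplier y v p0 p \<zeta>) \<and>
       (\<forall>p0 p \<zeta>. costate_multiplier y v p0 p \<zeta> \<longrightarrow>
          (\<forall>i\<ge>1. \<forall>t\<in>{tau \<alpha> T (i - 1)<..<tau \<alpha> T i}.
             p t $ 1 = - p0 / 6 * (\<Prod>b\<leftarrow>[\<beta>1, \<beta>2, \<beta>3]. t - (1 - b) * tau \<alpha> T (i - 1) - b * tau \<alpha> T i) \<and>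
             ((\<lambda>s. p s $ 1) has_real_derivative - p t $ 2) (at t) \<and>
             ((\<lambda>s. p s $ 2) has_real_derivative - p t $ 3) (at t) \<and>
             (p0, p t) \<noteq> 0)))"
proof -
  obtain \<alpha> T Tinf \<beta>1 \<beta>2 \<beta>3 :: real where sys: "beta_system \<alpha> T Tinf \<beta>1 \<beta>2 \<beta>3"
    and num: "\<bar>\<alpha> - 0.1660687\<bar> \<le> 5 / 10^8" "\<bar>T - 4.2479105\<bar> \<le> 5 / 10^8" "\<bar>Tinf - 5.0938372\<bar> \<le> 5 / 10^8"
      "\<bar>\<beta>1 - 0.4698574\<bar> \<le> 5 / 10^8" "\<bar>\<beta>2 - 0.8716996\<bar> \<le> 5 / 10^8" "\<bar>\<beta>3 - 1.0283610\<bar> \<le> 5 / 10^8"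
    using beta_system_exists by blast
  interpret chattering \<alpha> T Tinf \<beta>1 \<beta>2 \<beta>3
    by unfold_locales (use sys num in simp_all)
  show ?thesis
  proof (rule exI[of _ \<alpha>], rule exI[of _ T], rule exI[of _ Tinf], rule exI[of _ \<beta>1], rule exI[of _ \<beta>2],
      rule exI[of _ \<beta>3], intro conjI)
    show "beta_system \<alpha> T Tinf \<beta>1 \<beta>2 \<beta>3" by (rule sys)
    show "\<forall>\<alpha>' T' Tinf' \<beta>1' \<beta>2' \<beta>3'. beta_system \<alpha>' T' Tinf' \<beta>1' \<beta>2' \<beta>3' \<longrightarrow>
       \<alpha>' = \<alpha> \<and> T' = T \<and> Tinf' = Tinf \<and> \<beta>1' = \<beta>1 \<and> \<beta>2' = \<beta>2 \<and> \<beta>3' = \<beta>3"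
      using beta_system_unique[OF sys] by blast
    show "\<exists>y v. optimal y v" using ystar_optimal by blast
    show "\<forall>y v. optimal y v \<longrightarrow>
       (\<forall>i. y (tau \<alpha> T i) = \<alpha>^i *\<^sub>R axis 1 1) \<and>
       {t. junction_time y t} = range (tau \<alpha> T) \<and>
       (\<forall>i\<ge>1. AE \<beta> in lborel.
          (\<beta> \<in> {0<..<\<beta>1} \<longrightarrow> v ((1 - \<beta>) * tau \<alpha> T (i - 1) + \<beta> * tau \<alpha> T i) = -1) \<and>
          (\<beta> \<in> {\<beta>1<..<\<beta>2} \<longrightarrow> v ((1 - \<beta>) * tau \<alpha> T (i - 1) + \<beta> * tau \<alpha> T i) = 1) \<and>
          (\<beta> \<in> {\<beta>2<..<1} \<longrightarrow> v ((1 - \<beta>) * tau \<alpha> T (i - 1) + \<beta> * tau \<alpha> T i) = -1)) \<and>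
       (\<exists>p0 p \<zeta>. costate_multiplier y v p0 p \<zeta>) \<and>
       (\<forall>p0 p \<zeta>. costate_multiplier y v p0 p \<zeta> \<longrightarrow>
          (\<forall>i\<ge>1. \<forall>t\<in>{tau \<alpha> T (i - 1)<..<tau \<alpha> T i}.
             p t $ 1 = - p0 / 6 * (\<Prod>b\<leftarrow>[\<beta>1, \<beta>2, \<beta>3]. t - (1 - b) * tau \<alpha> T (i - 1) - b * tau \<alpha> T i) \<and>
             ((\<lambda>s. p s $ 1) has_real_derivative - p t $ 2) (at t) \<and>
             ((\<lambda>s. p s $ 2) has_real_derivative - p t $ 3) (at t) \<and>
             (p0, p t) \<noteq> 0))"
    proof (intro allI impI)
      fix y v assume opt: "optimal y v"
      note U = optimal_unique[OF opt]
      have J: "junction_time y t \<longleftrightarrow> t \<in> range \<tau>" for t using U(3) by (rule junction_time_iff)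
      have state: "y (\<tau> i) = \<alpha>^i *\<^sub>R axis 1 1" for i
        using U(2)[of "\<tau> i"] tau_less_inf[of i] by (simp add: vec_eq_iff forall_3 axis_def)
      have control: "AE \<beta> in lborel.
          (\<beta> \<in> {0<..<\<beta>1} \<longrightarrow> v ((1 - \<beta>) * \<tau> (i - 1) + \<beta> * \<tau> i) = -1) \<and>
          (\<beta> \<in> {\<beta>1<..<\<beta>2} \<longrightarrow> v ((1 - \<beta>) * \<tau> (i - 1) + \<beta> * \<tau> i) = 1) \<and>
          (\<beta> \<in> {\<beta>2<..<1} \<longrightarrow> v ((1 - \<beta>) * \<tau> (i - 1) + \<beta> * \<tau> i) = -1)" if i1: "1 \<le> i" for i
      proof -
        obtain j where i: "i = Suc j" using i1 by (cases i) auto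
        have "(1 - \<beta>) * \<tau> (i - 1) + \<beta> * \<tau> i = \<tau> j + \<beta> * (\<alpha>^j * T)" for \<beta>
          unfolding i tau_Suc by (simp add: algebra_simps)
        thus ?thesis using optimal_control_AE[OF opt, of j] by simp
      qed
      have costate: "p t $ 1 = - p0 / 6 * (\<Prod>b\<leftarrow>[\<beta>1, \<beta>2, \<beta>3]. t - (1 - b) * \<tau> (i - 1) - b * \<tau> i) \<and>
             ((\<lambda>s. p s $ 1) has_real_derivative - p t $ 2) (at t) \<and>
             ((\<lambda>s. p s $ 2) has_real_derivative - p t $ 3) (at t) \<and> (p0, p t) \<noteq> 0"
        if cm: "costate_multiplier y v p0 p \<zeta>" and i1: "1 \<le> i" and t: "t \<in> {\<tau> (i - 1)<..<\<tau> i}" for p0 p \<zeta> i t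
      proof -
        obtain j where i: "i = Suc j" using i1 by (cases i) auto
        have tj: "\<tau> j < t" "t < \<tau> (Suc j)" using t i by auto
        hence "0 \<le> t" using tau_nonneg[of j] by linarith
        hence "(p0, p t) \<noteq> 0" using cm unfolding costate_multiplier_def by blast
        moreover have e: "t - (1 - b) * \<tau> (i - 1) - b * \<tau> i = t - \<tau> j - b * (\<alpha>^j * T)" for b
          unfolding i tau_Suc by (simp add: algebra_simps)
        ultimately show ?thesis
          using costate_unique[OF opt cm J tj] unfolding e by (simp add: mult.assoc)
      qed
      show "(\<forall>i. y (\<tau> i) = \<alpha>^i *\<^sub>R axis 1 1) \<and> {t. junction_time y t} = range \<tau> \<and>
       (\<forall>i\<ge>1. AE \<beta> in lborel.
          (\<beta> \<in> {0<..<\<beta>1} \<longrightarrow> v ((1 - \<beta>) * \<tau> (i - 1) + \<beta> * \<tau> i) = -1) \<and>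
          (\<beta> \<in> {\<beta>1<..<\<beta>2} \<longrightarrow> v ((1 - \<beta>) * \<tau> (i - 1) + \<beta> * \<tau> i) = 1) \<and>
          (\<beta> \<in> {\<beta>2<..<1} \<longrightarrow> v ((1 - \<beta>) * \<tau> (i - 1) + \<beta> * \<tau> i) = -1)) \<and>
       (\<exists>p0 p \<zeta>. costate_multiplier y v p0 p \<zeta>) \<and>
       (\<forall>p0 p \<zeta>. costate_multiplier y v p0 p \<zeta> \<longrightarrow>
          (\<forall>i\<ge>1. \<forall>t\<in>{\<tau> (i - 1)<..<\<tau> i}.
             p t $ 1 = - p0 / 6 * (\<Prod>b\<leftarrow>[\<beta>1, \<beta>2, \<beta>3]. t - (1 - b) * \<tau> (i - 1) - b * \<tau> i) \<and>
             ((\<lambda>s. p s $ 1) has_real_derivative - p t $ 2) (at t) \<and>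
             ((\<lambda>s. p s $ 2) has_real_derivative - p t $ 3) (at t) \<and>
             (p0, p t) \<noteq> 0))"
      proof (intro conjI)
        show "\<forall>i. y (\<tau> i) = \<alpha>^i *\<^sub>R axis 1 1" using state by blast
        show "{t. junction_time y t} = range \<tau>" using J by blast
      qed (use control costate qstar_costate[OF opt] in blast)+
    qed
  qed (rule num)+
qed

end
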